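(* Assume the Continuum Hypothesis ($2^{\aleph_0}=\aleph_1$). Then there is a regular, hereditarily Lindelöf (Hausdorff) topological space of cardinality $\aleph_1$ that is not a D-space.
   Context: "Space" means Hausdorff topological space. A space is Lindelöf if every open cover of it has a countable subcover; it is hereditarily Lindelöf if every subspace is Lindelöf. A neighborhood assignment on a space $X$ is a family $\{N(x) : x\in X\}$ of open subsets of $X$ with $x\in N(x)$ for all $x\in X$. A space $X$ is a D-space if for every neighborhood assignment $\{N(x): x\in X\}$ there is a closed discrete set $D\subseteq X$ (closed in $X$ and discrete in the subspace topology) such that $X=\bigcup_{x\in D}N(x)$. *)

theory Defs
  imports "HOL-Analysis.Analysis"
begin

unbundle cardinal_syntax

abbreviation aleph1 :: "nat set rel" where
  "aleph1 \<equiv> cardSuc natLeq"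

definition continuum_hypothesis :: bool where
  "continuum_hypothesis \<longleftrightarrow> ctwo ^c natLeq =o aleph1"

text \<open>
  Only the values of \<open>N\<close> at points of the space matter: a total function restricted to
  \<open>topspace X\<close> represents the family indexed by the points of \<open>X\<close>.
\<close>

definition neighbourhood_assignment :: "'a topology \<Rightarrow> ('a \<Rightarrow> 'a set) \<Rightarrow> bool" where
  "neighbourhood_assignment X N \<longleftrightarrow> (\<forall>x \<in> topspace X. openin X (N x) \<and> x \<in> N x)"

definition closed_discrete_in :: "'a topology \<Rightarrow> 'a set \<Rightarrow> bool" where
  "closed_discrete_in X D \<longleftrightarrow> closedin X D \<and> subtopology X D = discrete_topology D"

text \<open>
  As for \<open>regular_space\<close> in the library, the Hausdorff axiom is not part of the definition
  and has to be stated separately.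
\<close>

definition D_space :: "'a topology \<Rightarrow> bool" where
  "D_space X \<longleftrightarrow>
     (\<forall>N. neighbourhood_assignment X N \<longrightarrow>
        (\<exists>D. closed_discrete_in X D \<and> topspace X = (\<Union>x\<in>D. N x)))"

end

theory Submission
  imports Defs "HOL-Library.Countable_Set_Type"
begin

text \<open>
  Let \<open>I\<close> be a set well-ordered in type \<open>\<omega>\<^sub>1\<close>. The space is a subspace \<open>{z a | a \<in> I}\<close> of
  the power of the two-point space with exponent \<open>\<nat> + I\<close>, so it is regular and Hausdorff. The
  points satisfy \<open>z a (b) = 0\<close> for all \<open>b \<ge> a\<close>, and the neighbourhood assignment is
  \<open>N a = {y. z y (a) = 0}\<close>. A set \<open>D\<close> fails to witness the D-property as soon as one point \<open>z y\<close> is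
  constantly \<open>1\<close> on \<open>D\<close>. In a hereditarily Lindeloef space closed discrete sets are countable. Hence it
  is enough that every countable \<open>D\<close> either is not closed or has such a \<open>y\<close>.

  Under the Continuum Hypothesis all countable subsets of \<open>I\<close> can be listed as \<open>E a \<subseteq> {..<a}\<close>, and
  stage \<open>a\<close> of a recursion deals with \<open>E a\<close>. Each point is chosen generically (in the sense of Cohen
  forcing over countably many given tasks) in a slab, the set of all \<open>x\<close> with \<open>x = 1\<close> on a set
  \<open>B a\<close> and \<open>x = 0\<close> on \<open>{l a..}\<close>. If \<open>z ` E a\<close> is dense in a relatively open part of an
  earlier slab, possibly cut down at some \<open>m\<close>, then \<open>z a\<close> is chosen there, so that \<open>a\<close>
  becomes a limit point of \<open>E a\<close>, and \<open>E a\<close> is not closed. Otherwise \<open>B a = E a\<close> and \<open>l a = a\<close>: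
  the point \<open>z a\<close> is \<open>1\<close> on \<open>E a\<close>. This alone settles the failure of the D-property.

  The difficulty is that the space remains hereditarily Lindeloef, although each
  \<open>B a\<close> removes genericity from \<open>z a\<close>. Let basic neighbourhoods \<open>cyl (q s)\<close> of the points \<open>s\<close> of a
  set \<open>S\<close> be given, and take \<open>y \<in> S\<close> beyond a sufficiently closed countable ordinal. By genericity of
  \<open>z y\<close> it suffices to find an early \<open>s \<in> S\<close> of the same type as \<open>y\<close> such that the coordinates
  at which \<open>q s\<close> prescribes the value \<open>0\<close> avoid \<open>B y\<close> (apart from a fixed finite part, on
  which \<open>z y\<close> agrees with \<open>q s\<close> anyway). If such coordinates were trapped in \<open>B y\<close>, one
  could consider copies \<open>s\<close> of \<open>y\<close> reaching slightly further; for a coordinate \<open>a\<close> of such a copy,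
  genericity of \<open>z a\<close> says that the trapped coordinates are dense in a part of the slab of \<open>z a\<close>. But
  \<open>B y\<close> comes from a stage later than \<open>a\<close> at which precisely this was excluded. The
  coordinates are freed from \<open>B y\<close> one at a time by \<open>avoid_fresh\<close>;
  \<open>cover_bounded\<close> draws the conclusion, and \<open>countable_closed_misses\<close> is the failure of the
  D-property.
\<close>

section \<open>Conditions and generic points of slabs\<close>

type_synonym 'c condition = "('c \<times> bool) list"

definition cyl :: "'c condition \<Rightarrow> ('c \<Rightarrow> bool) set" where
  "cyl p = {x. \<forall>(c, b) \<in> set p. x c = b}"

lemma cylD: "x \<in> cyl p \<Longrightarrow> (c, b) \<in> set p \<Longrightarrow> x c = b"
  by (auto simp: cyl_def)

lemma cyl_Nil [simp]: "cyl [] = UNIV"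
  by (simp add: cyl_def)

lemma cyl_append [simp]: "cyl (p @ q) = cyl p \<inter> cyl q"
  by (auto simp: cyl_def)

lemma cyl_single [simp]: "cyl [(c, b)] = {x. x c = b}"
  by (simp add: cyl_def)

text \<open>
  The set \<open>Z\<close> is dense in the nonempty part \<open>K \<inter> cyl p\<close> of \<open>K\<close>; it need not be contained in it.
\<close>

definition dense_on :: "('c \<Rightarrow> bool) set \<Rightarrow> ('c \<Rightarrow> bool) set \<Rightarrow> 'c condition \<Rightarrow> bool" where
  "dense_on Z K p \<longleftrightarrow>
     K \<inter> cyl p \<noteq> {} \<and> (\<forall>q. K \<inter> cyl p \<inter> cyl q \<noteq> {} \<longrightarrow> Z \<inter> cyl p \<inter> cyl q \<noteq> {})"

text \<open>
  Genericity of \<open>x\<close> with respect to \<open>P\<close>: the point does not lie on the boundary, relative to \<open>K\<close>, of the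
  open set \<open>\<Union>q\<in>P. cyl q\<close>.
\<close>

definition decides :: "('c \<Rightarrow> bool) set \<Rightarrow> 'c condition set \<Rightarrow> ('c \<Rightarrow> bool) \<Rightarrow> bool" where
  "decides K P x \<longleftrightarrow>
     (\<exists>q \<in> P. x \<in> cyl q) \<or> (\<exists>p. x \<in> cyl p \<and> (\<forall>q \<in> P. K \<inter> cyl p \<inter> cyl q = {}))"

definition slab :: "'i set \<Rightarrow> 'i::wellorder \<Rightarrow> (nat + 'i \<Rightarrow> bool) set" where
  "slab B l = {x. (\<forall>a \<in> B. x (Inr a)) \<and> (\<forall>a \<ge> l. \<not> x (Inr a))}"

text \<open>
  An instance of the compactness of slabs: coordinates on which the conditions are silent receive the
  value that the slab wants.
\<close>

lemma slab_limit_point: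
  fixes p :: "nat \<Rightarrow> (nat + 'i::wellorder) condition"
  assumes B: "B \<subseteq> {..<l}"
    and chain: "\<And>n. set (p n) \<subseteq> set (p (Suc n))"
    and ne: "\<And>n. slab B l \<inter> cyl (p n) \<noteq> {}"
  shows "\<exists>x \<in> slab B l. \<forall>n. x \<in> cyl (p n)"
proof -
  define R where "R = (\<Union>n. set (p n))"
  have mono: "set (p m) \<subseteq> set (p n)" if "m \<le> n" for m n
    using that chain by (rule lift_Suc_mono_le[rotated])
  have witness: "\<exists>y \<in> slab B l. y c = b \<and> y c' = b'" if inR: "(c, b) \<in> R" "(c', b') \<in> R" for c b c' b'
  proof -
    obtain m n where "(c, b) \<in> set (p m)" "(c', b') \<in> set (p n)"
      using inR unfolding R_def by blast
    then have *: "(c, b) \<in> set (p (max m n))" "(c', b') \<in> set (p (max m n))"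
      using mono[of m "max m n"] mono[of n "max m n"] by auto
    obtain y where "y \<in> slab B l" "y \<in> cyl (p (max m n))"
      using ne by blast
    moreover have "y c = b" "y c' = b'"
      using * \<open>y \<in> cyl (p (max m n))\<close> by (auto simp: cyl_def)
    ultimately show ?thesis by blast
  qed
  define x where "x = (\<lambda>c. (c, True) \<in> R \<or> (c, False) \<notin> R \<and> c \<in> Inr ` B)"
  have val: "x c = b" if "(c, b) \<in> R" for c b
    using that witness[of c True c False] by (cases b) (auto simp: x_def)
  have "x \<in> slab B l"
  proof -
    have "x (Inr a)" if "a \<in> B" for a
      using that witness[of "Inr a" False "Inr a" False] by (auto simp: x_def slab_def)
    moreover have "\<not> x (Inr a)" if "a \<ge> l" for a
      using that B witness[of "Inr a" True "Inr a" True] by (force simp: x_def slab_def)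
    ultimately show ?thesis by (auto simp: slab_def)
  qed
  moreover have "x \<in> cyl (p n)" for n
    using val by (auto simp: cyl_def R_def)
  ultimately show ?thesis by blast
qed

text \<open>
  The Baire category theorem for slabs. The coordinates in \<open>\<nat>\<close> are never restricted by a slab; they
  serve to keep the point away from a given countable set \<open>Y\<close>.
\<close>

lemma slab_generic_point:
  fixes B :: "'i::wellorder set"
  assumes B: "B \<subseteq> {..<l}" and p: "slab B l \<inter> cyl p \<noteq> {}"
    and "countable \<P>" and "countable Y"
  shows "\<exists>x \<in> slab B l \<inter> cyl p. (\<forall>P \<in> \<P>. decides (slab B l) P x) \<and> x \<notin> Y"
proof -
  let ?K = "slab B l"
  obtain P :: "nat \<Rightarrow> (nat + 'i) condition set" where P: "\<P> \<subseteq> range P"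
    using \<open>countable \<P>\<close> by (metis countable_empty range_from_nat_into subset_refl empty_subsetI)
  obtain y :: "nat \<Rightarrow> (nat + 'i \<Rightarrow> bool)" where y: "Y \<subseteq> range y"
    using \<open>countable Y\<close> by (metis countable_empty range_from_nat_into subset_refl empty_subsetI)
  have step: "\<exists>s. ?K \<inter> cyl s \<noteq> {} \<and> set r \<subseteq> set s \<and> y n \<notin> cyl s \<and>
      ((\<exists>q \<in> P n. cyl s \<subseteq> cyl q) \<or> (\<forall>q \<in> P n. ?K \<inter> cyl s \<inter> cyl q = {}))"
    if r: "?K \<inter> cyl r \<noteq> {}" for r n
  proof -
    obtain s where s: "?K \<inter> cyl s \<noteq> {}" "set r \<subseteq> set s"
      "(\<exists>q \<in> P n. cyl s \<subseteq> cyl q) \<or> (\<forall>q \<in> P n. ?K \<inter> cyl s \<inter> cyl q = {})"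
    proof (cases "\<exists>q \<in> P n. ?K \<inter> cyl r \<inter> cyl q \<noteq> {}")
      case True
      then obtain q where q: "q \<in> P n" "?K \<inter> cyl r \<inter> cyl q \<noteq> {}" by blast
      show ?thesis
        by (rule that[of "r @ q"]) (use q in \<open>auto simp: Int_assoc\<close>)
    next
      case False
      then show ?thesis using r that[of r] by blast
    qed
    obtain x where x: "x \<in> ?K" "x \<in> cyl s" using s by blast
    have "infinite (range (Inl :: nat \<Rightarrow> nat + 'i))"
      by (simp add: finite_image_iff)
    then obtain c where c: "c \<in> range (Inl :: nat \<Rightarrow> nat + 'i)" "c \<notin> fst ` set s"
      by (metis List.finite_set finite_imageI finite_subset subsetI)
    let ?x = "x(c := \<not> y n c)"
    have "?x \<in> ?K" using x(1) c(1) by (auto simp: slab_def)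
    moreover have "?x \<in> cyl s"
      unfolding cyl_def
    proof (clarify)
      fix d b assume d: "(d, b) \<in> set s"
      then have "d \<noteq> c" using c(2) by force
      then show "?x d = b" using x(2) d by (auto simp: cyl_def)
    qed
    ultimately have "?x \<in> ?K \<inter> cyl (s @ [(c, \<not> y n c)])"
      by simp
    then have "?K \<inter> cyl (s @ [(c, \<not> y n c)]) \<noteq> {}"
      by blast
    moreover have "cyl (s @ [(c, \<not> y n c)]) \<subseteq> cyl s" "y n \<notin> cyl (s @ [(c, \<not> y n c)])"
      by simp_all
    moreover have "set r \<subseteq> set (s @ [(c, \<not> y n c)])"
      using s(2) by auto
    ultimately show ?thesis
      using s(3) by (intro exI[of _ "s @ [(c, \<not> y n c)]"]) blast
  qed
  define good where "good n r s \<longleftrightarrow> set r \<subseteq> set s \<and> y n \<notin> cyl s \<and>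
      ((\<exists>q \<in> P n. cyl s \<subseteq> cyl q) \<or> (\<forall>q \<in> P n. ?K \<inter> cyl s \<inter> cyl q = {}))" for n r s
  have "\<exists>f. \<forall>n. (?K \<inter> cyl (f n) \<noteq> {} \<and> (n = 0 \<longrightarrow> f n = p)) \<and> good n (f n) (f (Suc n))"
  proof (rule dependent_nat_choice[where Q = good])
    show "\<exists>r. ?K \<inter> cyl r \<noteq> {} \<and> (0 = 0 \<longrightarrow> r = p)"
      using p by blast
    show "\<exists>s. (?K \<inter> cyl s \<noteq> {} \<and> (Suc n = 0 \<longrightarrow> s = p)) \<and> good n r s"
      if "?K \<inter> cyl r \<noteq> {} \<and> (n = 0 \<longrightarrow> r = p)" for r n
      using step[of r n] that by (simp add: good_def)
  qed
  then obtain f where f0: "f 0 = p" and fne: "\<And>n. ?K \<inter> cyl (f n) \<noteq> {}"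
    and good: "\<And>n. good n (f n) (f (Suc n))"
    by blast
  have fS: "\<And>n. set (f n) \<subseteq> set (f (Suc n))" "\<And>n. y n \<notin> cyl (f (Suc n))"
      "\<And>n. (\<exists>q \<in> P n. cyl (f (Suc n)) \<subseteq> cyl q) \<or>
         (\<forall>q \<in> P n. ?K \<inter> cyl (f (Suc n)) \<inter> cyl q = {})"
    using good unfolding good_def by blast+
  obtain x where x: "x \<in> ?K" "\<And>n. x \<in> cyl (f n)"
    using slab_limit_point[of B l f, OF B fS(1) fne] by blast
  have "decides ?K (P n) x" for n
    using fS(3)[of n] x(2)[of "Suc n"] unfolding decides_def by blast
  moreover have "x \<noteq> y n" for n
    using fS(2)[of n] x(2)[of "Suc n"] by auto
  ultimately show ?thesis
    using x(1) x(2)[of 0] f0 P y by blast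
qed

section \<open>Well-orders of type omega one\<close>

text \<open>
  The function \<open>seq\<close> lists all countable sequences of indices. On an uncountable set all of whose initial
  segments are countable, such a listing amounts to the Continuum Hypothesis.
\<close>

locale omega_one =
  fixes seq :: "'i::wellorder \<Rightarrow> nat \<Rightarrow> 'i"
  assumes countable_below: "countable {..<a::'i}"
    and uncountable_UNIV: "uncountable (UNIV :: 'i set)"
    and surj_seq: "surj seq"
begin

lemma countable_bounded:
  assumes "countable (C :: 'i set)"
  shows "\<exists>d. \<forall>c \<in> C. c < d"
proof (rule ccontr)
  assume "\<not> ?thesis"
  then have "UNIV \<subseteq> (\<Union>c \<in> C. insert c {..<c})"
    by (force simp: not_less le_less)
  moreover have "countable (\<Union>c \<in> C. insert c {..<c})"
    using assms countable_below by auto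
  ultimately show False
    using uncountable_UNIV countable_subset by blast
qed

text \<open>
  A set must be listed at a place above all its elements. The first term of a sequence is ignored,
  so every set occurs uncountably often, hence arbitrarily late.
\<close>

lemma enumerate_countable_subsets:
  "\<exists>E :: 'i \<Rightarrow> 'i set. (\<forall>a. E a \<subseteq> {..<a}) \<and> (\<forall>C. countable C \<longrightarrow> C \<noteq> {} \<longrightarrow> (\<exists>a. E a = C))"
proof -
  define tails where "tails a = range (\<lambda>n. seq a (Suc n))" for a
  define E where "E a = (if tails a \<subseteq> {..<a} then tails a else {})" for a
  have "\<exists>a. E a = C" if C: "countable C" "C \<noteq> {}" for C
  proof -
    obtain d where d: "\<And>c. c \<in> C \<Longrightarrow> c < d"
      using countable_bounded[OF C(1)] by blast
    obtain v :: "nat \<Rightarrow> 'i" where v: "range v = C"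
      using C by (metis range_from_nat_into)
    have "\<exists>a. seq a = case_nat i v" for i
      using surj_seq by (metis surjD)
    then obtain g where g: "\<And>i. seq (g i) = case_nat i v" by metis
    have "inj g"
      by (rule injI) (metis g old.nat.simps(4))
    then have "uncountable (range g)"
      using uncountable_UNIV countable_image_inj_on by blast
    then have "\<not> range g \<subseteq> {..<d}"
      using countable_below countable_subset by blast
    then obtain i where i: "d \<le> g i" by (metis image_subset_iff lessThan_iff not_less)
    have "tails (g i) = C"
      by (simp add: tails_def g v)
    moreover have "C \<subseteq> {..<g i}" using d i by force
    ultimately show ?thesis unfolding E_def by metis
  qed
  then show ?thesis
    by (intro exI[of _ E]) (auto simp: E_def)
qed

text \<open>
  A countable set of conditions is coded by a sequence: the even terms list the coordinates in use,
  and the odd ones tell, by comparison with the first odd term, which of the countably many conditions over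
  \<open>\<nat>\<close> and the names \<open>0, 1, 2, \<dots>\<close> of these coordinates belong to the set.
\<close>

lemma enumerate_countable_condition_sets:
  "\<exists>\<Phi> :: 'i \<Rightarrow> (nat + 'i) condition set. \<forall>P. countable P \<longrightarrow> (\<exists>a. \<Phi> a = P)"
proof -
  define rename :: "(nat \<Rightarrow> 'i) \<Rightarrow> (nat + nat) condition \<Rightarrow> (nat + 'i) condition"
    where "rename v = map (map_prod (map_sum id v) id)" for v
  define dec :: "(nat \<Rightarrow> 'i) \<Rightarrow> (nat + 'i) condition set"
    where "dec u = rename (\<lambda>n. u (2 * n)) ` {p. u (2 * Suc (to_nat p) + 1) = u 1}" for u
  have "\<exists>u. dec u = P" if P: "countable P" for P
  proof -
    let ?A = "\<Union>p \<in> P. {a. Inr a \<in> fst ` set p}"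
    have "finite {a. Inr a \<in> fst ` set p}" for p :: "(nat + 'i) condition"
      by (rule finite_vimageI[of "fst ` set p" Inr, unfolded vimage_def]) auto
    then have "countable ?A"
      using P by (blast intro: countable_finite)
    then obtain v :: "nat \<Rightarrow> 'i" where v: "?A \<subseteq> range v"
      by (metis range_from_nat_into subset_refl empty_subsetI)
    have ren: "p \<in> range (rename v)" if "p \<in> P" for p
    proof -
      have "cb \<in> range (map_prod (map_sum id v) id)" if cb: "cb \<in> set p" for cb
      proof (cases cb)
        case (Pair c b)
        show ?thesis
        proof (cases c)
          case (Inl n)
          then show ?thesis using Pair by (auto intro: image_eqI[of _ _ "(Inl n, b)"])
        next
          case (Inr a)
          then have "a \<in> ?A" using Pair cb \<open>p \<in> P\<close> by force
          then obtain n where "a = v n" using v by blast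
          then show ?thesis using Pair Inr by (auto intro: image_eqI[of _ _ "(Inr n, b)"])
        qed
      qed
      then have "p \<in> lists (range (map_prod (map_sum id v) id))" by auto
      then show ?thesis unfolding rename_def lists_image by auto
    qed
    obtain i j :: 'i where ij: "i \<noteq> j"
    proof -
      have "\<not> (UNIV :: 'i set) \<subseteq> {undefined}"
        using uncountable_UNIV countable_subset by blast
      then show ?thesis using that by auto
    qed
    define u where "u n = (if even n then v (n div 2)
        else if n = 1 then i
        else if rename v (from_nat (n div 2 - 1)) \<in> P then i else j)" for n
    have "(\<lambda>n. u (2 * n)) = v" by (simp add: u_def fun_eq_iff)
    moreover have "u (2 * Suc (to_nat p) + 1) = u 1 \<longleftrightarrow> rename v p \<in> P" for p
      using ij by (simp add: u_def)
    ultimately have "dec u = P"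
      unfolding dec_def using ren by auto
    then show ?thesis by blast
  qed
  then have "\<exists>a. dec (seq a) = P" if "countable P" for P
    using that surjD[OF surj_seq] by metis
  then show ?thesis by blast
qed

end

section \<open>The recursive construction\<close>

text \<open>
  The points with index in \<open>C\<close> are dense in a part of the slab given by \<open>B\<close> and \<open>l\<close>, cut down at
  \<open>m\<close>. Cutting down is what makes the notion applicable to initial pieces of later sets: a family of
  points with indices below \<open>m\<close> sees only the part of a slab below \<open>m\<close>.
\<close>

definition reaches :: "('i::wellorder \<Rightarrow> nat + 'i \<Rightarrow> bool) \<Rightarrow> 'i set \<Rightarrow>
    'i set \<Rightarrow> 'i \<Rightarrow> 'i \<Rightarrow> (nat + 'i) condition \<Rightarrow> bool" where
  "reaches z C B l m p \<longleftrightarrow> m \<le> l \<and> dense_on (z ` C) (slab (B \<inter> {..<m}) m) p"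

text \<open>
  The two alternatives of \<open>stage\<close> are the two ways to prevent \<open>E a\<close> from witnessing the D-property: either
  \<open>z a\<close> is \<open>1\<close> on \<open>E a\<close>, or \<open>z a\<close> is a limit of \<open>z ` E a\<close>. The first one is permitted only
  if no earlier slab is reached by \<open>E a\<close>, since otherwise later points would be too far from
  generic for the Lindeloef property.
\<close>

locale tower = omega_one seq
  for seq :: "'i::wellorder \<Rightarrow> nat \<Rightarrow> 'i" +
  fixes E :: "'i \<Rightarrow> 'i set" and \<Phi> :: "'i \<Rightarrow> (nat + 'i) condition set"
    and z :: "'i \<Rightarrow> nat + 'i \<Rightarrow> bool" and B :: "'i \<Rightarrow> 'i set" and l :: "'i \<Rightarrow> 'i"
  assumes E_below: "E a \<subseteq> {..<a}"
    and E_surj: "countable C \<Longrightarrow> C \<noteq> {} \<Longrightarrow> \<exists>a. E a = C"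
    and \<Phi>_surj: "countable P \<Longrightarrow> \<exists>a. \<Phi> a = P"
    and B_below: "B a \<subseteq> {..<l a}"
    and l_le: "l a \<le> a"
    and z_slab: "z a \<in> slab (B a) (l a)"
    and z_decides: "c < a \<Longrightarrow> decides (slab (B a) (l a)) (\<Phi> c) (z a)"
    and inj_z: "inj z"
    and stage: "(B a = E a \<and> l a = a \<and> \<not> (\<exists>g < a. \<exists>m p. reaches z (E a) (B g) (l g) m p)) \<or>
      (\<exists>g < a. \<exists>m p. reaches z (E a) (B g) (l g) m p \<and>
          B a = B g \<inter> {..<m} \<and> l a = m \<and> z a \<in> cyl p)"

context omega_one
begin

lemma next_stage:
  fixes a :: 'i and z :: "'i \<Rightarrow> nat + 'i \<Rightarrow> bool"
  assumes E: "E \<subseteq> {..<a}" and lB: "\<And>g. g < a \<Longrightarrow> l g \<le> g"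
  shows "\<exists>x B' m. B' \<subseteq> {..<m} \<and> m \<le> a \<and> x \<in> slab B' m \<and> (\<forall>c < a. decides (slab B' m) (\<Phi> c) x) \<and>
      (\<forall>c < a. x \<noteq> z c) \<and>
      ((B' = E \<and> m = a \<and> \<not> (\<exists>g < a. \<exists>m p. reaches z E (B g) (l g) m p)) \<or>
       (\<exists>g < a. \<exists>p. reaches z E (B g) (l g) m p \<and> B' = B g \<inter> {..<m} \<and> x \<in> cyl p))"
proof -
  have generic: "\<exists>x \<in> slab B' m \<inter> cyl p. (\<forall>c < a. decides (slab B' m) (\<Phi> c) x) \<and> (\<forall>c < a. x \<noteq> z c)"
    if "B' \<subseteq> {..<m}" "slab B' m \<inter> cyl p \<noteq> {}" for B' m p
  proof -
    have "countable (\<Phi> ` {..<a})" "countable (z ` {..<a})"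
      using countable_below by auto
    from slab_generic_point[OF that this]
    obtain x where "x \<in> slab B' m \<inter> cyl p" "\<forall>P \<in> \<Phi> ` {..<a}. decides (slab B' m) P x"
      "x \<notin> z ` {..<a}"
      by (elim bexE conjE)
    then show ?thesis
      by (intro bexI[of _ x]) auto
  qed
  show ?thesis
  proof (cases "\<exists>g < a. \<exists>m p. reaches z E (B g) (l g) m p")
    case True
    then obtain g m p where g: "g < a" and r: "reaches z E (B g) (l g) m p" by blast
    have "slab (B g \<inter> {..<m}) m \<inter> cyl p \<noteq> {}"
      using r by (auto simp: reaches_def dense_on_def)
    then obtain x where "x \<in> slab (B g \<inter> {..<m}) m \<inter> cyl p"
      "\<forall>c < a. decides (slab (B g \<inter> {..<m}) m) (\<Phi> c) x" "\<forall>c < a. x \<noteq> z c"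
      using generic[of "B g \<inter> {..<m}" m p] by blast
    moreover have "m \<le> a"
      using r lB[OF g] g unfolding reaches_def by (meson le_less_trans less_imp_le order_trans)
    ultimately show ?thesis
      using g r by (intro exI[of _ x] exI[of _ "B g \<inter> {..<m}"] exI[of _ m]) blast
  next
    case False
    have "(\<lambda>c. c \<in> Inr ` E) \<in> slab E a"
      using E by (force simp: slab_def)
    then obtain x where "x \<in> slab E a" "\<forall>c < a. decides (slab E a) (\<Phi> c) x" "\<forall>c < a. x \<noteq> z c"
      using generic[of E a "[]"] E by (auto simp del: not_all)
    then show ?thesis
      using E False by (intro exI[of _ x] exI[of _ E] exI[of _ a]) blast
  qed
qed

lemma tower_exists: "\<exists>E \<Phi> z B l. tower seq E \<Phi> z B l"
proof -
  obtain E :: "'i \<Rightarrow> 'i set" where E: "\<And>a. E a \<subseteq> {..<a}"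
    "\<And>C. countable C \<Longrightarrow> C \<noteq> {} \<Longrightarrow> \<exists>a. E a = C"
    using enumerate_countable_subsets by blast
  obtain \<Phi> :: "'i \<Rightarrow> (nat + 'i) condition set" where \<Phi>: "\<And>P. countable P \<Longrightarrow> \<exists>a. \<Phi> a = P"
    using enumerate_countable_condition_sets by blast
  define Q where "Q f a r \<longleftrightarrow> (case r of (x, B', m) \<Rightarrow>
      B' \<subseteq> {..<m} \<and> m \<le> a \<and> x \<in> slab B' m \<and> (\<forall>c < a. decides (slab B' m) (\<Phi> c) x) \<and>
      (\<forall>c < a. x \<noteq> fst (f c)) \<and>
      ((B' = E a \<and> m = a \<and> \<not> (\<exists>g < a. \<exists>m p. reaches (fst \<circ> f) (E a) (fst (snd (f g))) (snd (snd (f g))) m p)) \<or>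
       (\<exists>g < a. \<exists>p. reaches (fst \<circ> f) (E a) (fst (snd (f g))) (snd (snd (f g))) m p \<and>
          B' = fst (snd (f g)) \<inter> {..<m} \<and> x \<in> cyl p)))"
    for f :: "'i \<Rightarrow> (nat + 'i \<Rightarrow> bool) \<times> 'i set \<times> 'i" and a r
  have "\<exists>f. \<forall>a. Q f a (f a)"
  proof (rule dependent_wf_choice[OF wf])
    show "Q f a r = Q g a r" if "\<And>c. (c, a) \<in> {(x, y). x < y} \<Longrightarrow> f c = g c" for f g a r
    proof -
      have eq: "f c = g c" if "c < a" for c using \<open>c < a\<close> that \<open>\<And>c. (c, a) \<in> _ \<Longrightarrow> _\<close> by simp
      then have "(fst \<circ> f) ` E a = (fst \<circ> g) ` E a"
        using E(1)[of a] by (intro image_cong) auto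
      then show ?thesis
        unfolding Q_def reaches_def by (simp add: eq cong: conj_cong split: prod.splits)
    qed
    show "\<exists>r. Q f a r" if "\<And>c. (c, a) \<in> {(x, y). x < y} \<Longrightarrow> Q f c (f c)" for f a
    proof -
      have "snd (snd (f g)) \<le> g" if "g < a" for g
        using \<open>\<And>c. (c, a) \<in> _ \<Longrightarrow> _\<close>[of g] \<open>g < a\<close> by (auto simp: Q_def split: prod.splits)
      from next_stage[OF E(1)[of a] this, where z = "fst \<circ> f" and B = "\<lambda>g. fst (snd (f g))" and \<Phi> = \<Phi>]
      show ?thesis
        unfolding Q_def by (simp only: split_paired_Ex prod.case) (simp add: comp_def)
    qed
  qed
  then obtain f where f: "\<And>a. Q f a (f a)" by blast
  define z B l where "z = fst \<circ> f" and "B = (\<lambda>a. fst (snd (f a)))" and "l = (\<lambda>a. snd (snd (f a)))"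
  have fQ: "B a \<subseteq> {..<l a} \<and> l a \<le> a \<and> z a \<in> slab (B a) (l a) \<and>
      (\<forall>c < a. decides (slab (B a) (l a)) (\<Phi> c) (z a)) \<and> (\<forall>c < a. z a \<noteq> z c) \<and>
      ((B a = E a \<and> l a = a \<and> \<not> (\<exists>g < a. \<exists>m p. reaches z (E a) (B g) (l g) m p)) \<or>
       (\<exists>g < a. \<exists>p. reaches z (E a) (B g) (l g) (l a) p \<and>
          B a = B g \<inter> {..<l a} \<and> z a \<in> cyl p))" for a
    using f[of a] unfolding Q_def z_def B_def l_def by (cases "f a") (simp add: comp_def)
  have "inj z"
    by (rule injI) (metis fQ linorder_neq_iff)
  then have "tower seq E \<Phi> z B l"
  proof (unfold_locales, goal_cases)
    case (9 a)
    then show ?case using fQ[of a] by blast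
  qed (use E \<Phi> fQ in simp_all)
  then show ?thesis by blast
qed

end

section \<open>Types of conditions and closed ordinals\<close>

definition cond_pars :: "(nat + 'i) condition \<Rightarrow> 'i set" where
  "cond_pars p = {a. Inr a \<in> fst ` set p}"

definition restrict_cond :: "'i::wellorder \<Rightarrow> (nat + 'i) condition \<Rightarrow> (nat + 'i) condition" where
  "restrict_cond d p = filter (\<lambda>(c, b). \<forall>a. c = Inr a \<longrightarrow> a < d) p"

lemma finite_cond_pars [simp]: "finite (cond_pars p)"
  unfolding cond_pars_def by (rule finite_vimageI[of "fst ` set p" Inr, unfolded vimage_def]) auto

lemma cond_pars_append [simp]: "cond_pars (p @ q) = cond_pars p \<union> cond_pars q"
  by (auto simp: cond_pars_def)

lemma cond_pars_Nil [simp]: "cond_pars [] = {}"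
  by (auto simp: cond_pars_def)

lemma cond_parsI: "(Inr a, b) \<in> set p \<Longrightarrow> a \<in> cond_pars p"
  by (force simp: cond_pars_def)

lemma cond_pars_restrict: "cond_pars (restrict_cond d p) \<subseteq> {..<d}"
  by (auto simp: cond_pars_def restrict_cond_def)

lemma cyl_subset_restrict: "cyl p \<subseteq> cyl (restrict_cond d p)"
  by (auto simp: cyl_def restrict_cond_def)

text \<open>
  A list of entries describes the type of a condition \<open>q s\<close>, one entry for each element of the list
  \<open>q s\<close>. A fixed entry names the element. A moving entry gives only the value and leaves the
  coordinate \<open>a \<in> I\<close> open, but requires that the point \<open>z a\<close> lie in \<open>cyl r\<close>. Types with parameters
  below a countable ordinal are countable in number; they replace the formulas of an elementary submodel
  argument.
\<close>

datatype 'i entry = Fixed "nat + 'i" bool | Moving bool "(nat + 'i) condition"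

primrec entry_pars :: "'i entry \<Rightarrow> 'i set" where
  "entry_pars (Fixed c b) = {a. c = Inr a}"
| "entry_pars (Moving b r) = cond_pars r"

definition spec_pars :: "'i entry list \<Rightarrow> 'i set" where
  "spec_pars \<sigma> = (\<Union>e \<in> set \<sigma>. entry_pars e)"

lemma finite_entry_pars [simp]: "finite (entry_pars e)"
proof (cases e)
  case (Fixed c b)
  have "{a. c = Inr a} \<subseteq> {projr c}" by auto
  then show ?thesis using Fixed finite_subset by fastforce
qed simp

lemma finite_spec_pars [simp]: "finite (spec_pars \<sigma>)"
  by (simp add: spec_pars_def)

lemma spec_pars_append_Cons [simp]:
  "spec_pars (s @ e # t) = spec_pars s \<union> entry_pars e \<union> spec_pars t"
  by (auto simp: spec_pars_def)

lemma countable_conditions_below: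
  assumes "countable A"
  shows "countable {p :: (nat + 'i) condition. cond_pars p \<subseteq> A}"
proof (rule countable_subset)
  show "{p :: (nat + 'i) condition. cond_pars p \<subseteq> A} \<subseteq> lists ((range Inl \<union> Inr ` A) \<times> UNIV)"
  proof (intro subsetI in_listsI ballI)
    fix p :: "(nat + 'i) condition" and cb
    assume p: "p \<in> {p. cond_pars p \<subseteq> A}" "cb \<in> set p"
    obtain c b where cb: "cb = (c, b)" by force
    show "cb \<in> (range Inl \<union> Inr ` A) \<times> UNIV"
      using p cb cond_parsI[of _ b p] by (cases c) auto
  qed
qed (use assms in auto)

lemma countable_specs_below:
  assumes "countable A"
  shows "countable {\<sigma> :: 'i entry list. spec_pars \<sigma> \<subseteq> A}"
proof (rule countable_subset)
  let ?C = "{p :: (nat + 'i) condition. cond_pars p \<subseteq> A}"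
  let ?e = "case_prod Fixed ` ((range Inl \<union> Inr ` A) \<times> UNIV) \<union> case_prod Moving ` (UNIV \<times> ?C)"
  show "{\<sigma> :: 'i entry list. spec_pars \<sigma> \<subseteq> A} \<subseteq> lists ?e"
  proof (intro subsetI in_listsI ballI)
    fix \<sigma> :: "'i entry list" and e
    assume "\<sigma> \<in> {\<sigma>. spec_pars \<sigma> \<subseteq> A}" "e \<in> set \<sigma>"
    then have e: "entry_pars e \<subseteq> A" by (auto simp: spec_pars_def)
    show "e \<in> ?e"
    proof (cases e)
      case (Fixed c b)
      then have "c \<in> range Inl \<union> Inr ` A" using e by (cases c) auto
      then show ?thesis using Fixed by force
    next
      case (Moving b r)
      then show ?thesis using e by force
    qed
  qed
  show "countable (lists ?e)"
    using assms by (intro countable_lists countable_Un countable_image countable_SIGMA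
        countable_conditions_below) auto
qed

text \<open>
  Iterate a majorant of \<open>h\<close> countably often, starting at \<open>c\<close>, and take the least strict upper bound.
\<close>

lemma (in omega_one) closed_index:
  fixes h :: "'i \<Rightarrow> 'i"
  shows "\<exists>d > c. \<forall>x < d. h x < d"
proof -
  have "\<exists>y > x. \<forall>w \<le> x. h w < y" for x
  proof -
    have "{..x} = insert x {..<x}" by auto
    then have "countable (insert x (h ` {..x}))" using countable_below by simp
    then show ?thesis using countable_bounded[of "insert x (h ` {..x})"] by auto
  qed
  then obtain k where k: "\<And>x. x < k x" "\<And>x w. w \<le> x \<Longrightarrow> h w < k x" by metis
  define u where "u n = (k ^^ n) c" for n
  obtain d0 where "\<forall>n. u n < d0"
    using countable_bounded[of "range u"] by auto
  define d where "d = (LEAST d. \<forall>n. u n < d)"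
  have d: "u n < d" for n
    using LeastI[of "\<lambda>d. \<forall>n. u n < d"] \<open>\<forall>n. u n < d0\<close> by (auto simp: d_def)
  have "h x < d" if "x < d" for x
  proof -
    have "\<not> (\<forall>n. u n < x)" using not_less_Least that unfolding d_def by blast
    then obtain n where "x \<le> u n" by (auto simp: not_less)
    then have "h x < u (Suc n)" using k(2) by (simp add: u_def)
    then show ?thesis using d less_trans by blast
  qed
  moreover have "c < d" using d[of 0] by (simp add: u_def)
  ultimately show ?thesis by blast
qed

lemma bounded_below_limit:
  fixes d :: "'i::wellorder"
  assumes "finite A" and "A \<subseteq> {..<d}" and "c < d" and limit: "\<And>x. x < d \<Longrightarrow> \<exists>y < d. x < y"
  shows "\<exists>g < d. c \<le> g \<and> (\<forall>a \<in> A. a < g)"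
proof -
  have "Max (insert c A) < d" using assms by auto
  then obtain g where "g < d" "Max (insert c A) < g" using limit by blast
  then show ?thesis using \<open>finite A\<close> by (intro exI[of _ g]) auto
qed

text \<open>
  A choice of basic neighbourhoods for the points of an arbitrary set \<open>S\<close>, as needed to test the Lindeloef
  property.
\<close>

locale tower_cover = tower seq E \<Phi> z B l
  for seq :: "'i::wellorder \<Rightarrow> nat \<Rightarrow> 'i" and E \<Phi> z B l +
  fixes S :: "'i set" and q :: "'i \<Rightarrow> (nat + 'i) condition"
  assumes z_cyl: "s \<in> S \<Longrightarrow> z s \<in> cyl (q s)"
begin

definition matches :: "'i \<Rightarrow> (nat + 'i) \<times> bool \<Rightarrow> 'i entry \<Rightarrow> bool" where
  "matches g cb e \<longleftrightarrow> (case e of Fixed c b \<Rightarrow> cb = (c, b)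
     | Moving b r \<Rightarrow> \<exists>a \<ge> g. cb = (Inr a, b) \<and> z a \<in> cyl r)"

definition fits :: "'i \<Rightarrow> 'i \<Rightarrow> 'i entry list \<Rightarrow> bool" where
  "fits g s \<sigma> \<longleftrightarrow> list_all2 (matches g) (q s) \<sigma>"

text \<open>
  The number \<open>g\<close> in \<open>fits g s \<sigma>\<close> is a lower bound for the moving coordinates; a type is unbounded if it is
  realised with moving coordinates beyond any bound.
\<close>

definition unbounded :: "'i entry list \<Rightarrow> bool" where
  "unbounded \<sigma> \<longleftrightarrow> (\<forall>g. \<exists>s \<in> S. fits g s \<sigma>)"

definition lies_below :: "'i \<Rightarrow> 'i \<Rightarrow> bool" where
  "lies_below d s \<longleftrightarrow> s < d \<and> cond_pars (q s) \<subseteq> {..<d}"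

lemma fits_antimono: "fits g s \<sigma> \<Longrightarrow> g' \<le> g \<Longrightarrow> fits g' s \<sigma>"
  unfolding fits_def
  by (erule list_all2_mono) (auto simp: matches_def split: entry.splits)

lemma fits_nth: "fits g s (\<sigma> @ e # \<tau>) \<Longrightarrow> matches g (q s ! length \<sigma>) e \<and> q s ! length \<sigma> \<in> set (q s)"
  unfolding fits_def
  using list_all2_nthD2[of "matches g" "q s" "\<sigma> @ e # \<tau>" "length \<sigma>"]
    list_all2_lengthD[of "matches g" "q s" "\<sigma> @ e # \<tau>"]
  by simp

lemma fits_replace:
  assumes "fits g s (\<sigma> @ e # \<tau>)" and "matches g (q s ! length \<sigma>) e'"
  shows "fits g s (\<sigma> @ e' # \<tau>)"
  using assms unfolding fits_def list_all2_conv_all_nth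
  by (auto simp: nth_append nth_Cons split: nat.splits if_splits)

lemma fits_entry:
  assumes "fits g s \<sigma>" and "cb \<in> set (q s)"
  shows "\<exists>e \<in> set \<sigma>. matches g cb e"
  using assms unfolding fits_def list_all2_conv_all_nth by (metis in_set_conv_nth)

text \<open>
  One step of closing off: beyond \<open>h\<close> no bounded type over \<open>g\<close> is realised any more, and each unbounded one
  is realised between \<open>g\<close> and \<open>h\<close>.
\<close>

lemma hop_exists:
  "\<exists>h > g. \<forall>\<sigma>. spec_pars \<sigma> \<subseteq> {..<g} \<longrightarrow>
     (unbounded \<sigma> \<longrightarrow> (\<exists>s \<in> S. fits g s \<sigma> \<and> lies_below h s)) \<and>
     (\<not> unbounded \<sigma> \<longrightarrow> (\<forall>s \<in> S. \<not> fits h s \<sigma>))"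
proof -
  have "\<exists>w. \<forall>h > w. (unbounded \<sigma> \<longrightarrow> (\<exists>s \<in> S. fits g s \<sigma> \<and> lies_below h s)) \<and>
     (\<not> unbounded \<sigma> \<longrightarrow> (\<forall>s \<in> S. \<not> fits h s \<sigma>))" for \<sigma>
  proof (cases "unbounded \<sigma>")
    case True
    then obtain s where s: "s \<in> S" "fits g s \<sigma>" unfolding unbounded_def by blast
    obtain w where w: "\<forall>c \<in> insert s (cond_pars (q s)). c < w"
      using countable_bounded[of "insert s (cond_pars (q s))"] by (auto simp: countable_finite)
    have "lies_below h s" if "h > w" for h
      using w that unfolding lies_below_def by (auto intro: less_trans)
    then show ?thesis using True s by blast
  next
    case False
    then obtain w where "\<forall>s \<in> S. \<not> fits w s \<sigma>" unfolding unbounded_def by blast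
    then have "\<forall>s \<in> S. \<not> fits h s \<sigma>" if "h > w" for h
      using fits_antimono that less_imp_le by blast
    then show ?thesis using False by blast
  qed
  then obtain w where w: "\<And>\<sigma> h. h > w \<sigma> \<Longrightarrow> (unbounded \<sigma> \<longrightarrow> (\<exists>s \<in> S. fits g s \<sigma> \<and> lies_below h s)) \<and>
     (\<not> unbounded \<sigma> \<longrightarrow> (\<forall>s \<in> S. \<not> fits h s \<sigma>))"
    by metis
  have "countable (insert g (w ` {\<sigma>. spec_pars \<sigma> \<subseteq> {..<g}}))"
    using countable_specs_below[OF countable_below] by simp
  from countable_bounded[OF this] obtain h where
    "\<forall>c \<in> insert g (w ` {\<sigma>. spec_pars \<sigma> \<subseteq> {..<g}}). c < h" by blast
  then show ?thesis using w by (intro exI[of _ h]) blast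
qed

definition hop :: "'i \<Rightarrow> 'i" where
  "hop g = (SOME h. h > g \<and> (\<forall>\<sigma>. spec_pars \<sigma> \<subseteq> {..<g} \<longrightarrow>
     (unbounded \<sigma> \<longrightarrow> (\<exists>s \<in> S. fits g s \<sigma> \<and> lies_below h s)) \<and>
     (\<not> unbounded \<sigma> \<longrightarrow> (\<forall>s \<in> S. \<not> fits h s \<sigma>))))"

lemma hop:
  shows less_hop: "g < hop g"
    and hop_unbounded: "spec_pars \<sigma> \<subseteq> {..<g} \<Longrightarrow> unbounded \<sigma> \<Longrightarrow> \<exists>s \<in> S. fits g s \<sigma> \<and> lies_below (hop g) s"
    and hop_bounded: "spec_pars \<sigma> \<subseteq> {..<g} \<Longrightarrow> s \<in> S \<Longrightarrow> fits (hop g) s \<sigma> \<Longrightarrow> unbounded \<sigma>"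
  using someI_ex[OF hop_exists[of g]] unfolding hop_def[symmetric] by blast+

text \<open>
  Such ordinals play the role of \<open>M \<inter> \<omega>\<^sub>1\<close> for a countable elementary submodel \<open>M\<close>: a type over
  \<open>d\<close> realised beyond \<open>d\<close> is unbounded, and unbounded types over \<open>d\<close> are realised cofinally below \<open>d\<close>.
\<close>

definition hop_closed :: "'i \<Rightarrow> bool" where
  "hop_closed d \<longleftrightarrow> (\<exists>c. c < d) \<and> (\<forall>x < d. hop x < d)"

lemma hop_closed_exists: "\<exists>d > c. hop_closed d"
  using closed_index[of c hop] unfolding hop_closed_def by blast

lemma hop_closed_bound:
  assumes "hop_closed d" and "finite A" and "A \<subseteq> {..<d}" and "c < d"
  shows "\<exists>g < d. c \<le> g \<and> (\<forall>a \<in> A. a < g)"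
  using assms bounded_below_limit[of A d c] less_hop unfolding hop_closed_def by blast

lemma hop_closed_spec:
  assumes d: "hop_closed d" and \<sigma>: "spec_pars \<sigma> \<subseteq> {..<d}" and c: "c < d"
  shows "\<exists>g < d. c \<le> g \<and> spec_pars \<sigma> \<subseteq> {..<g}"
  using hop_closed_bound[OF d finite_spec_pars \<sigma> c] by blast

text \<open>
  The finitely many parameters of \<open>\<sigma>\<close> lie below some \<open>g < d\<close>, and a bound for \<open>\<sigma>\<close> would be found
  below \<open>hop g < d\<close>.
\<close>

lemma reflect_fit:
  assumes d: "hop_closed d" and \<sigma>: "spec_pars \<sigma> \<subseteq> {..<d}" and s: "s \<in> S" "fits d s \<sigma>"
  shows "unbounded \<sigma>"
proof -
  obtain c where "c < d" using d unfolding hop_closed_def by blast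
  then obtain g where g: "g < d" "spec_pars \<sigma> \<subseteq> {..<g}"
    using hop_closed_spec[OF d \<sigma>] by blast
  then have "hop g \<le> d" using d unfolding hop_closed_def by (simp add: less_imp_le)
  then show ?thesis using hop_bounded[OF g(2) s(1)] fits_antimono[OF s(2)] by blast
qed

lemma realise:
  assumes d: "hop_closed d" and \<sigma>: "spec_pars \<sigma> \<subseteq> {..<d}" "unbounded \<sigma>" and c: "c < d"
  shows "\<exists>s \<in> S. fits c s \<sigma> \<and> lies_below d s"
proof -
  obtain g where g: "g < d" "c \<le> g" "spec_pars \<sigma> \<subseteq> {..<g}"
    using hop_closed_spec[OF d \<sigma>(1) c] by blast
  then obtain s where "s \<in> S" "fits g s \<sigma>" "lies_below (hop g) s"
    using hop_unbounded \<sigma>(2) by blast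
  moreover have "hop g < d" using d g unfolding hop_closed_def by blast
  ultimately show ?thesis
    using fits_antimono[OF _ g(2)] unfolding lies_below_def by (meson less_trans lessThan_subset_iff less_imp_le subset_trans)
qed

lemma unboundedI:
  assumes d: "hop_closed d" and \<sigma>: "spec_pars \<sigma> \<subseteq> {..<d}" and fit: "\<And>g. g < d \<Longrightarrow> \<exists>s \<in> S. fits g s \<sigma>"
  shows "unbounded \<sigma>"
proof -
  obtain c where "c < d" using d unfolding hop_closed_def by blast
  then obtain g where g: "g < d" "spec_pars \<sigma> \<subseteq> {..<g}"
    using hop_closed_spec[OF d \<sigma>] by blast
  then have "hop g < d" using d unfolding hop_closed_def by blast
  then show ?thesis using fit hop_bounded[OF g(2)] by blast
qed

section \<open>One moving coordinate avoids a fresh set\<close>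

text \<open>
  The coordinates below \<open>d\<close> that can occur at position \<open>n\<close> in realisations of \<open>\<sigma>\<close> beyond \<open>g\<close>, where the value
  \<open>0\<close> is prescribed.
\<close>

definition moving :: "'i \<Rightarrow> 'i entry list \<Rightarrow> nat \<Rightarrow> 'i \<Rightarrow> 'i set" where
  "moving d \<sigma> n g = {a. a < d \<and> (\<exists>s \<in> S. fits g s \<sigma> \<and> q s ! n = (Inr a, False))}"

text \<open>
  The conditions over \<open>d\<close> that are missed by the points with such coordinates from some \<open>g < d\<close> on. They form a
  countable set, so points with a sufficiently large index decide it.
\<close>

definition avoided :: "'i \<Rightarrow> 'i entry list \<Rightarrow> nat \<Rightarrow> (nat + 'i) condition set" where
  "avoided d \<sigma> n = {p. cond_pars p \<subseteq> {..<d} \<and> (\<exists>g < d. \<forall>a \<in> moving d \<sigma> n g. z a \<notin> cyl p)}"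

lemma z_zero: "l a \<le> c \<Longrightarrow> \<not> z a (Inr c)"
  using z_slab[of a] by (auto simp: slab_def)

text \<open>
  Points with index below \<open>d\<close> vanish beyond \<open>d\<close>, as does every point of a slab ending at or below \<open>d\<close>. So
  only the part of a condition below \<open>d\<close> matters if the condition is consistent with such a slab.
\<close>

lemma z_cyl_unrestrict:
  assumes a: "a < d" and x: "x \<in> slab B' m" "m \<le> d" "x \<in> cyl p" and z: "z a \<in> cyl (restrict_cond d p)"
  shows "z a \<in> cyl p"
  unfolding cyl_def
proof clarify
  fix c b assume cb: "(c, b) \<in> set p"
  show "z a c = b"
  proof (cases "\<exists>i \<ge> d. c = Inr i")
    case True
    then obtain i where i: "c = Inr i" "d \<le> i" by blast
    have "\<not> x c" using x(1,2) i by (auto simp: slab_def)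
    then have "\<not> b" using x(3) cb by (auto simp: cyl_def)
    moreover have "\<not> z a c" using z_zero[of a i] l_le[of a] a i by simp
    ultimately show ?thesis by simp
  next
    case False
    then have "\<forall>i. c = Inr i \<longrightarrow> i < d" using not_le by blast
    then have "(c, b) \<in> set (restrict_cond d p)" using cb by (simp add: restrict_cond_def)
    then show ?thesis using z by (auto simp: cyl_def)
  qed
qed

text \<open>
  A point of the slab of \<open>z a\<close> cut down at \<open>d\<close> extends to a point of the whole slab: continue with \<open>z a\<close>
  beyond \<open>d\<close>.
\<close>

lemma splice:
  assumes x: "x \<in> slab (B a \<inter> {..<min (l a) d}) (min (l a) d)"
  shows "(\<lambda>c. if \<forall>i. c = Inr i \<longrightarrow> i < d then x c else z a c) \<in> slab (B a) (l a)"
proof -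
  have "x (Inr b)" if "b \<in> B a" "b < d" for b
    using x that B_below[of a] by (auto simp: slab_def)
  moreover have "\<not> x (Inr b)" if "l a \<le> b" for b
    using x that by (simp add: slab_def min_le_iff_disj)
  ultimately show ?thesis
    using z_slab[of a] by (simp add: slab_def)
qed

lemma splice_cyl:
  assumes "x \<in> cyl (restrict_cond d p)" and "y \<in> cyl p"
  shows "(\<lambda>c. if \<forall>i. c = Inr i \<longrightarrow> i < d then x c else y c) \<in> cyl p"
  using assms unfolding cyl_def restrict_cond_def by (simp add: split_beta)

lemma splice_cyl_below:
  assumes "x \<in> cyl p" and "cond_pars p \<subseteq> {..<d}"
  shows "(\<lambda>c. if \<forall>i. c = Inr i \<longrightarrow> i < d then x c else y c) \<in> cyl p"
  unfolding cyl_def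
proof clarify
  fix c b assume cb: "(c, b) \<in> set p"
  then have "i < d" if "c = Inr i" for i
    using that assms(2) cond_parsI[of i b p] by auto
  moreover have "x c = b"
    using assms(1) cb by (auto simp: cyl_def)
  ultimately show "(if \<forall>i. c = Inr i \<longrightarrow> i < d then x c else y c) = b"
    by simp
qed

text \<open>
  The heart of the argument. A realisation \<open>s\<close> beyond \<open>d\<close> gives a coordinate \<open>a\<close>. The point \<open>z a\<close> lies in no
  avoided condition: adding such a condition to the moving entry would give a type over \<open>d\<close>, realised by
  \<open>s\<close> beyond \<open>d\<close> and hence also arbitrarily high below \<open>d\<close>, where the condition is avoided.
  As \<open>z a\<close> decides the set of avoided conditions, the coordinates realising the type below \<open>d\<close> are dense in a part of the slab of \<open>z a\<close>
  cut down at \<open>d\<close>. The set \<open>C\<close> is not dense in this part, so some condition there is missed by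
  \<open>z ` C\<close> but met by realisations arbitrarily high below \<open>d\<close>. This condition may be added to the moving entry.
\<close>

lemma avoid_fresh:
  assumes d: "hop_closed d" and \<sigma>: "spec_pars (\<sigma> @ Moving False r # \<tau>) \<subseteq> {..<d}"
    and s: "s \<in> S" "fits d s (\<sigma> @ Moving False r # \<tau>)" and a: "q s ! length \<sigma> = (Inr a, False)"
    and dec: "decides (slab (B a) (l a)) (avoided d (\<sigma> @ Moving False r # \<tau>) (length \<sigma>)) (z a)"
    and fresh: "\<not> (\<exists>m p. reaches z C (B a) (l a) m p)"
  shows "\<exists>r'. cond_pars r' \<subseteq> {..<d} \<and> unbounded (\<sigma> @ Moving False r' # \<tau>) \<and>
    (\<forall>x \<in> C. x < d \<longrightarrow> z x \<notin> cyl r')"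
proof -
  let ?\<sigma> = "\<sigma> @ Moving False r # \<tau>" and ?n = "length \<sigma>" and ?m = "min (l a) d"
  let ?K = "slab (B a) (l a)" and ?L = "slab (B a \<inter> {..<?m}) ?m"
  let ?W = "moving d ?\<sigma> ?n"
  have r: "cond_pars r \<subseteq> {..<d}" using \<sigma> by auto
  have strengthen: "fits g t (\<sigma> @ Moving False (r @ p) # \<tau>)"
    if "fits g t ?\<sigma>" "q t ! ?n = (Inr c, False)" "z c \<in> cyl p" for g t c p
    using fits_replace[OF that(1)] fits_nth[OF that(1)] that(2,3) by (auto simp: matches_def)
  have neg: "z a \<notin> cyl p" if av: "p \<in> avoided d ?\<sigma> ?n" for p
  proof
    assume z: "z a \<in> cyl p"
    have p: "cond_pars p \<subseteq> {..<d}" using that by (simp add: avoided_def)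
    obtain g where g: "g < d" "\<And>a. a \<in> ?W g \<Longrightarrow> z a \<notin> cyl p"
      using av unfolding avoided_def by blast
    let ?\<rho> = "\<sigma> @ Moving False (r @ p) # \<tau>"
    have \<rho>: "spec_pars ?\<rho> \<subseteq> {..<d}" using \<sigma> p by auto
    have "fits d s ?\<rho>" using strengthen[OF s(2) a z] .
    then have "unbounded ?\<rho>" using reflect_fit[OF d \<rho> s(1)] by blast
    then obtain t where t: "t \<in> S" "fits g t ?\<rho>" "lies_below d t"
      using realise[OF d \<rho> _ g(1)] by blast
    obtain c where c: "q t ! ?n = (Inr c, False)" "c \<ge> g" "z c \<in> cyl r" "z c \<in> cyl p"
      "q t ! ?n \<in> set (q t)"
      using fits_nth[OF t(2)] by (auto simp: matches_def)
    have "c < d" using c(1,5) t(3) cond_parsI[of c False] unfolding lies_below_def by auto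
    moreover have "fits g t ?\<sigma>"
      using fits_replace[OF t(2)] c by (auto simp: matches_def)
    ultimately have "c \<in> ?W g" using t c unfolding moving_def by blast
    then show False using g(2) c(4) by blast
  qed
  then obtain p where p: "z a \<in> cyl p" "\<And>p'. p' \<in> avoided d ?\<sigma> ?n \<Longrightarrow> ?K \<inter> cyl p \<inter> cyl p' = {}"
  proof -
    have "\<not> (\<exists>p' \<in> avoided d ?\<sigma> ?n. z a \<in> cyl p')" using neg by (intro notI, elim bexE) simp
    then have "\<exists>p. z a \<in> cyl p \<and> (\<forall>p' \<in> avoided d ?\<sigma> ?n. ?K \<inter> cyl p \<inter> cyl p' = {})"
      using dec unfolding decides_def by simp
    then show ?thesis using that by (elim exE conjE) simp
  qed
  \<comment> \<open>Here \<open>p\<close> forces that no avoided condition holds; its part below \<open>d\<close> is a place where the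
    realisations are dense.\<close>
  define p0 where "p0 = restrict_cond d p"
  \<comment> \<open>The point \<open>w\<close> is \<open>z a\<close> cut down at the end of the smaller slab.\<close>
  define w where "w = (\<lambda>c. if \<exists>i \<ge> ?m. c = Inr i then False else z a c)"
  have "w \<in> ?L"
    using z_slab[of a] unfolding slab_def w_def by (auto simp: not_le)
  moreover have "w \<in> cyl p0"
    unfolding cyl_def
  proof clarify
    fix c b assume "(c, b) \<in> set p0"
    then have cb: "(c, b) \<in> set p" "\<And>i. c = Inr i \<Longrightarrow> i < d" by (auto simp: p0_def restrict_cond_def)
    have "\<not> z a c" if "\<exists>i \<ge> ?m. c = Inr i"
      using that cb(2) z_zero[of a] by (auto simp: min_le_iff_disj)
    then have "w c = z a c" by (simp add: w_def)
    then show "w c = b" using cb(1) p(1) by (auto simp: cyl_def)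
  qed
  ultimately have "?L \<inter> cyl p0 \<noteq> {}" by blast
  moreover have "\<not> dense_on (z ` C) ?L p0"
    using fresh unfolding reaches_def by auto
  ultimately obtain p1 x where x: "x \<in> ?L" "x \<in> cyl p0" "x \<in> cyl p1"
    and C: "z ` C \<inter> cyl p0 \<inter> cyl p1 = {}"
    unfolding dense_on_def by blast
  define p2 where "p2 = restrict_cond d (p0 @ p1)"
  have p2: "cond_pars p2 \<subseteq> {..<d}" unfolding p2_def by (rule cond_pars_restrict)
  have xp2: "x \<in> cyl p2" using x cyl_subset_restrict unfolding p2_def by fastforce
  \<comment> \<open>If \<open>p2\<close> were avoided, then splicing \<open>x\<close> with \<open>z a\<close> would contradict the choice of \<open>p\<close>.\<close>
  have "p2 \<notin> avoided d ?\<sigma> ?n"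
  proof
    assume "p2 \<in> avoided d ?\<sigma> ?n"
    then have "?K \<inter> cyl p \<inter> cyl p2 = {}" by (rule p(2))
    moreover have "(\<lambda>c. if \<forall>i. c = Inr i \<longrightarrow> i < d then x c else z a c) \<in> ?K \<inter> cyl p \<inter> cyl p2"
      using splice[OF x(1)] splice_cyl[OF x(2)[unfolded p0_def] p(1)] splice_cyl_below[OF xp2 p2]
      by blast
    ultimately show False by blast
  qed
  then have dense: "\<exists>c \<in> ?W g. z c \<in> cyl p2" if "g < d" for g
    using that p2 unfolding avoided_def by blast
  have "unbounded (\<sigma> @ Moving False (r @ p2) # \<tau>)"
  proof (rule unboundedI[OF d])
    show "spec_pars (\<sigma> @ Moving False (r @ p2) # \<tau>) \<subseteq> {..<d}" using \<sigma> p2 by auto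
    show "\<exists>s \<in> S. fits g s (\<sigma> @ Moving False (r @ p2) # \<tau>)" if "g < d" for g
      using dense[OF that] strengthen unfolding moving_def by blast
  qed
  moreover have "z y \<notin> cyl (r @ p2)" if "y \<in> C" "y < d" for y
  proof
    assume "z y \<in> cyl (r @ p2)"
    then have "z y \<in> cyl (restrict_cond d (p0 @ p1))" by (simp add: p2_def)
    then have "z y \<in> cyl (p0 @ p1)"
      using z_cyl_unrestrict[OF that(2) x(1), of "p0 @ p1"] x(2,3) by simp
    then show False using C that(1) by auto
  qed
  moreover have "cond_pars (r @ p2) \<subseteq> {..<d}" using r p2 by simp
  ultimately show ?thesis by blast
qed

end

section \<open>The Lindeloef property\<close>

context tower
begin

text \<open>
  Cutting down commutes with itself, so every \<open>B a\<close> is an initial piece of a set \<open>E b\<close> that was taken over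
  unchanged at a stage \<open>b \<le> a\<close>, when it did not reach any slab before \<open>b\<close>.
\<close>

lemma origin:
  "\<exists>b. l a \<le> b \<and> b \<le> a \<and> B a = E b \<inter> {..<l a} \<and> \<not> (\<exists>g < b. \<exists>m p. reaches z (E b) (B g) (l g) m p)"
proof (induction a rule: less_induct)
  case (less a)
  show ?case
  proof (cases "B a = E a \<and> l a = a \<and> \<not> (\<exists>g < a. \<exists>m p. reaches z (E a) (B g) (l g) m p)")
    case True
    then show ?thesis using E_below[of a] by (intro exI[of _ a]) auto
  next
    case False
    then obtain g m p where g: "g < a" "reaches z (E a) (B g) (l g) m p" "B a = B g \<inter> {..<m}" "l a = m"
      using stage[of a] by blast
    obtain b where b: "l g \<le> b" "b \<le> g" "B g = E b \<inter> {..<l g}"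
      "\<not> (\<exists>g < b. \<exists>m p. reaches z (E b) (B g) (l g) m p)"
      using less[OF g(1)] by blast
    have "m \<le> l g" using g(2) by (simp add: reaches_def)
    then have "E b \<inter> {..<l g} \<inter> {..<m} = E b \<inter> {..<m}" by auto
    then have "B a = E b \<inter> {..<l a}" using g(3,4) b(3) by simp
    moreover have "l a \<le> b" "b \<le> a"
      using \<open>m \<le> l g\<close> g(1,4) b(1,2) by auto
    ultimately show ?thesis using b(4) by blast
  qed
qed

end

context tower_cover
begin

text \<open>
  A moving entry with value \<open>0\<close> has to keep its coordinate out of \<open>C\<close>, and a fixed entry has to agree
  with the point \<open>z y\<close> that is to be covered.
\<close>

definition killing :: "'i \<Rightarrow> 'i set \<Rightarrow> 'i entry \<Rightarrow> bool" where
  "killing d C e \<longleftrightarrow> (\<forall>r. e = Moving False r \<longrightarrow> (\<forall>x \<in> C. x < d \<longrightarrow> z x \<notin> cyl r))"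

definition true_at :: "'i \<Rightarrow> 'i entry \<Rightarrow> bool" where
  "true_at y e \<longleftrightarrow> (\<forall>c b. e = Fixed c b \<longrightarrow> z y c = b)"

text \<open>
  The moving entries are treated one after the other; \<open>\<sigma>\<close> is the part already done. The witnesses
  for \<open>avoid_fresh\<close> are found between \<open>k\<close> and \<open>hop k\<close>, that is, late enough to decide the sets in question
  and before the stage \<open>b\<close> from which \<open>C\<close> stems.
\<close>

lemma avoid_fresh_everywhere:
  assumes d: "hop_closed d" and k: "d \<le> k" "hop k \<le> b"
    and codes: "\<And>\<sigma> n. spec_pars \<sigma> \<subseteq> {..<d} \<Longrightarrow> \<exists>c < k. \<Phi> c = avoided d \<sigma> n"
    and fresh: "\<not> (\<exists>g < b. \<exists>m p. reaches z C (B g) (l g) m p)"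
  shows "spec_pars (\<sigma> @ \<tau>) \<subseteq> {..<d} \<Longrightarrow> unbounded (\<sigma> @ \<tau>) \<Longrightarrow> \<forall>e \<in> set \<sigma>. killing d C e \<Longrightarrow>
     \<forall>e \<in> set (\<sigma> @ \<tau>). true_at y e \<Longrightarrow>
     \<exists>\<rho>. spec_pars \<rho> \<subseteq> {..<d} \<and> unbounded \<rho> \<and> (\<forall>e \<in> set \<rho>. killing d C e \<and> true_at y e)"
proof (induction \<tau> arbitrary: \<sigma>)
  case Nil
  then show ?case by auto
next
  case (Cons e \<tau>)
  show ?case
  proof (cases "\<exists>r. e = Moving False r")
    case False
    then have "killing d C e" by (simp add: killing_def)
    then show ?thesis using Cons.IH[of "\<sigma> @ [e]"] Cons.prems by simp
  next
    case True
    then obtain r where e: "e = Moving False r" by blast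
    have \<sigma>: "spec_pars (\<sigma> @ Moving False r # \<tau>) \<subseteq> {..<d}" "unbounded (\<sigma> @ Moving False r # \<tau>)"
      using Cons.prems e by auto
    have "spec_pars (\<sigma> @ Moving False r # \<tau>) \<subseteq> {..<k}"
      using \<sigma>(1) k(1) by force
    then obtain s where s: "s \<in> S" "fits k s (\<sigma> @ Moving False r # \<tau>)" "lies_below (hop k) s"
      using hop_unbounded \<sigma>(2) by blast
    obtain a where a: "q s ! length \<sigma> = (Inr a, False)" "k \<le> a" "q s ! length \<sigma> \<in> set (q s)"
      using fits_nth[OF s(2)] by (auto simp: matches_def)
    have "a < hop k"
      using a(1,3) s(3) cond_parsI[of a False] unfolding lies_below_def by auto
    then have "a < b" using k(2) by simp
    then have "\<not> (\<exists>m p. reaches z C (B a) (l a) m p)" using fresh by blast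
    moreover obtain c where "c < k" "\<Phi> c = avoided d (\<sigma> @ Moving False r # \<tau>) (length \<sigma>)"
      using codes[OF \<sigma>(1)] by blast
    then have "decides (slab (B a) (l a)) (avoided d (\<sigma> @ Moving False r # \<tau>) (length \<sigma>)) (z a)"
      using z_decides[of c a] a(2) by simp
    ultimately obtain r' where r': "cond_pars r' \<subseteq> {..<d}" "unbounded (\<sigma> @ Moving False r' # \<tau>)"
      "\<forall>x \<in> C. x < d \<longrightarrow> z x \<notin> cyl r'"
      using avoid_fresh[OF d \<sigma>(1) s(1) fits_antimono[OF s(2) k(1)] a(1)] by blast
    let ?e = "Moving False r'"
    show ?thesis
    proof (rule Cons.IH[of "\<sigma> @ [?e]"])
      show "spec_pars ((\<sigma> @ [?e]) @ \<tau>) \<subseteq> {..<d}" using \<sigma>(1) r'(1) by simp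
      show "unbounded ((\<sigma> @ [?e]) @ \<tau>)" using r'(2) by simp
      show "\<forall>e \<in> set (\<sigma> @ [?e]). killing d C e" using Cons.prems(3) r'(3) by (simp add: killing_def)
      show "\<forall>e \<in> set ((\<sigma> @ [?e]) @ \<tau>). true_at y e" using Cons.prems(4) by (simp add: true_at_def)
    qed
  qed
qed

text \<open>
  The type of a condition over \<open>d\<close>: the coordinates below \<open>d\<close> are parameters, and the others move.
\<close>

definition shape :: "'i \<Rightarrow> (nat + 'i) condition \<Rightarrow> 'i entry list" where
  "shape d p = map (\<lambda>(c, b). if \<exists>a \<ge> d. c = Inr a then Moving b [] else Fixed c b) p"

lemma fits_shape: "fits d s (shape d (q s))"
  unfolding fits_def shape_def list.rel_map
  by (rule list.rel_refl_strong) (auto simp: matches_def)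

lemma spec_pars_shape: "spec_pars (shape d p) = {a \<in> cond_pars p. a < d}"
  by (force simp: spec_pars_def shape_def cond_pars_def not_le split: if_splits)

lemma true_at_shape:
  assumes "y \<in> S" and "e \<in> set (shape d (q y))"
  shows "true_at y e"
  using assms z_cyl[of y] unfolding shape_def true_at_def cyl_def by (auto split: if_splits)

text \<open>
  If the slab of \<open>z y\<close> ends early, then \<open>z y\<close> vanishes at all late coordinates, and so its type
  prescribes only zeros there. Any early copy \<open>s\<close> of \<open>y\<close> with moving coordinates beyond \<open>l y\<close> will do.
\<close>

lemma late_covered_low:
  assumes d: "hop_closed d" and y: "y \<in> S" "spec_pars (shape D (q y)) \<subseteq> {..<g}"
    and g: "g < d" "d \<le> D" "l y \<le> g"
  shows "\<exists>s \<in> S. s < d \<and> z y \<in> cyl (q s)"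
proof -
  let ?\<sigma> = "shape D (q y)"
  have \<sigma>: "spec_pars ?\<sigma> \<subseteq> {..<d}" using y(2) g(1) by force
  have "fits d y ?\<sigma>" using fits_antimono[OF fits_shape g(2)] .
  then have "unbounded ?\<sigma>" using reflect_fit[OF d \<sigma> y(1)] by blast
  then obtain s where s: "s \<in> S" "fits g s ?\<sigma>" "lies_below d s" using realise[OF d \<sigma> _ g(1)] by blast
  have "z y c = b" if cb: "(c, b) \<in> set (q s)" for c b
  proof -
    obtain e where e: "e \<in> set ?\<sigma>" "matches g (c, b) e" using fits_entry[OF s(2) cb] by blast
    show ?thesis
    proof (cases e)
      case (Fixed c' b')
      then show ?thesis using e true_at_shape[OF y(1) e(1)] by (auto simp: matches_def true_at_def)
    next
      case (Moving b' r)
      then obtain i where "i \<ge> D" "(Inr i, b') \<in> set (q y)"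
        using e(1) by (auto simp: shape_def split: if_splits)
      then have "\<not> b'"
        using cylD[OF z_cyl[OF y(1)]] z_zero[of y i] g by fastforce
      moreover obtain j where "c = Inr j" "b = b'" "g \<le> j"
        using e(2) Moving by (auto simp: matches_def)
      ultimately show ?thesis using z_zero[of y j] g(3) by auto
    qed
  qed
  then have "z y \<in> cyl (q s)" by (auto simp: cyl_def)
  then show ?thesis using s by (auto simp: lies_below_def)
qed

text \<open>
  If the slab of \<open>z y\<close> ends late, then \<open>B y\<close> stems from a stage \<open>b\<close> to which \<open>avoid_fresh_everywhere\<close>
  applies. If no early \<open>q s\<close> contained \<open>z y\<close>, a condition \<open>p\<close> true of \<open>z y\<close> would exclude all of them;
  but a suitable \<open>s\<close> has its moving coordinates away from \<open>p\<close>, and those with value \<open>0\<close> away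
  from \<open>B y\<close>. Changing \<open>z y\<close> to \<open>z s\<close> there leads to a point of the slab satisfying both conditions.
\<close>

lemma late_covered_high:
  assumes d: "hop_closed d" and y: "y \<in> S" "spec_pars (shape D (q y)) \<subseteq> {..<d}" "D \<le> l y"
    and k: "d \<le> k" "hop k \<le> D"
    and codes: "\<And>\<sigma> n. spec_pars \<sigma> \<subseteq> {..<d} \<Longrightarrow> \<exists>c < k. \<Phi> c = avoided d \<sigma> n"
    and code: "\<exists>c < k. \<Phi> c = q ` {s \<in> S. s < d}"
  shows "\<exists>s \<in> S. s < d \<and> z y \<in> cyl (q s)"
proof (rule ccontr)
  assume contra: "\<not> ?thesis"
  let ?\<sigma> = "shape D (q y)"
  have "d \<le> D" using k less_hop[of k] by simp
  obtain b where b: "l y \<le> b" "b \<le> y" "B y = E b \<inter> {..<l y}"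
    "\<not> (\<exists>g < b. \<exists>m p. reaches z (E b) (B g) (l g) m p)"
    using origin[of y] by blast
  obtain c where c: "c < k" "\<Phi> c = q ` {s \<in> S. s < d}" using code by blast
  have "c < y" using c(1) k(2) less_hop[of k] y(3) l_le[of y] by simp
  then have "decides (slab (B y) (l y)) (q ` {s \<in> S. s < d}) (z y)"
    using z_decides c(2) by metis
  then obtain p where p: "z y \<in> cyl p"
    and pn: "\<And>s. s \<in> S \<Longrightarrow> s < d \<Longrightarrow> slab (B y) (l y) \<inter> cyl p \<inter> cyl (q s) = {}"
    using contra unfolding decides_def by blast
  have "fits d y ?\<sigma>" using fits_antimono[OF fits_shape \<open>d \<le> D\<close>] .
  then have "unbounded ?\<sigma>" using reflect_fit[OF d y(2) y(1)] by blast
  moreover have "hop k \<le> b" using k(2) y(3) b(1) by simp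
  ultimately have "\<exists>\<rho>. spec_pars \<rho> \<subseteq> {..<d} \<and> unbounded \<rho> \<and>
      (\<forall>e \<in> set \<rho>. killing d (E b) e \<and> true_at y e)"
    using y(2) true_at_shape[OF y(1)]
    by (intro avoid_fresh_everywhere[OF d k(1) _ codes b(4), of "[]" ?\<sigma> y]) auto
  then obtain \<rho> where \<rho>: "spec_pars \<rho> \<subseteq> {..<d}" "unbounded \<rho>"
    "\<And>e. e \<in> set \<rho> \<Longrightarrow> killing d (E b) e" "\<And>e. e \<in> set \<rho> \<Longrightarrow> true_at y e"
    by blast
  obtain g where g: "g < d" "\<And>a. a \<in> cond_pars p \<Longrightarrow> a < d \<Longrightarrow> a < g"
  proof -
    obtain x where "x < d" using d unfolding hop_closed_def by blast
    from hop_closed_bound[OF d _ _ this, of "{a \<in> cond_pars p. a < d}"] show ?thesis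
      using that by auto
  qed
  obtain s where s: "s \<in> S" "fits g s \<rho>" "lies_below d s"
    using realise[OF d \<rho>(1,2) g(1)] by blast
  define x where "x = (\<lambda>c. if c \<in> Inr ` {g..<d} \<and> c \<in> fst ` set (q s) then z s c else z y c)"
  have x_val: "x c = b" if cb: "(c, b) \<in> set (q s)" for c b
  proof (cases "c \<in> Inr ` {g..<d}")
    case True
    then have "x c = z s c" using cb by (force simp: x_def)
    then show ?thesis using cylD[OF z_cyl[OF s(1)] cb] by simp
  next
    case False
    obtain e where e: "e \<in> set \<rho>" "matches g (c, b) e" using fits_entry[OF s(2) cb] by blast
    have "e = Fixed c b"
    proof (cases e)
      case (Moving b' r)
      then obtain i where i: "c = Inr i" "g \<le> i" using e(2) by (auto simp: matches_def)
      then have "i < d" using s(3) cb cond_parsI[of i b] by (auto simp: lies_below_def)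
      then show ?thesis using i False by auto
    qed (use e(2) in \<open>auto simp: matches_def\<close>)
    then have "z y c = b" using \<rho>(4)[OF e(1)] by (simp add: true_at_def)
    then show ?thesis using False by (simp add: x_def)
  qed
  have "x \<in> cyl (q s)"
    using x_val by (auto simp: cyl_def)
  moreover have "x \<in> cyl p"
    unfolding cyl_def
  proof clarify
    fix c b assume cb: "(c, b) \<in> set p"
    have "c \<notin> Inr ` {g..<d}"
    proof
      assume "c \<in> Inr ` {g..<d}"
      then obtain i where "c = Inr i" "g \<le> i" "i < d" by auto
      then show False using cond_parsI[of i b p] cb g(2)[of i] by simp
    qed
    then show "x c = b" using cylD[OF p cb] by (simp add: x_def)
  qed
  moreover have "x \<in> slab (B y) (l y)"
  proof -
    have "x (Inr a)" if a: "a \<in> B y" for a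
    proof (rule ccontr)
      assume xa: "\<not> x (Inr a)"
      have "z y (Inr a)" using z_slab[of y] a by (auto simp: slab_def)
      then have "a < d" "Inr a \<in> fst ` set (q s)" using xa by (auto simp: x_def split: if_splits)
      then have cb: "(Inr a, False) \<in> set (q s)" using xa x_val by force
      then obtain e where e: "e \<in> set \<rho>" "matches g (Inr a, False) e"
        using fits_entry[OF s(2)] by blast
      show False
      proof (cases e)
        case (Fixed c b)
        then show ?thesis using e \<rho>(4)[OF e(1)] \<open>z y (Inr a)\<close> by (auto simp: matches_def true_at_def)
      next
        case (Moving v r)
        then have "e = Moving False r" "z a \<in> cyl r" using e(2) by (auto simp: matches_def)
        moreover have "a \<in> E b" using a b(3) by blast
        ultimately show ?thesis using \<rho>(3)[OF e(1)] \<open>a < d\<close> by (auto simp: killing_def)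
      qed
    qed
    moreover have "\<not> x (Inr a)" if "l y \<le> a" for a
      using that z_zero[of y a] y(3) \<open>d \<le> D\<close> by (auto simp: x_def)
    ultimately show ?thesis by (auto simp: slab_def)
  qed
  ultimately show False
    using pn[OF s(1)] s(3) unfolding lies_below_def by blast
qed

text \<open>
  The bound \<open>D\<close> is closed under passing from \<open>g\<close> to a closed ordinal \<open>cl g\<close>, then to an ordinal \<open>K (cl g)\<close> beyond which
  all points decide the countably many relevant sets over \<open>cl g\<close>, and then one hop further. Thus
  for each \<open>y \<in> S\<close> there is a \<open>g < D\<close> beyond all parameters below \<open>D\<close> of the type of \<open>y\<close>, with the
  whole construction over \<open>g\<close> taking place below \<open>D\<close>.
\<close>

lemma cover_bounded: "\<exists>d. \<forall>y \<in> S. \<exists>s \<in> S. s < d \<and> z y \<in> cyl (q s)"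
proof -
  obtain cl where cl: "\<And>g. g < cl g" "\<And>g. hop_closed (cl g)" using hop_closed_exists by metis
  have code: "\<exists>k \<ge> d. (\<forall>\<sigma> n. spec_pars \<sigma> \<subseteq> {..<d} \<longrightarrow> (\<exists>c < k. \<Phi> c = avoided d \<sigma> n)) \<and>
      (\<exists>c < k. \<Phi> c = q ` {s \<in> S. s < d})" for d
  proof -
    have cs: "countable {\<sigma>. spec_pars \<sigma> \<subseteq> {..<d}}" using countable_specs_below[OF countable_below] .
    have "countable (avoided d \<sigma> n)" for \<sigma> n
      unfolding avoided_def
      by (rule countable_subset[OF _ countable_conditions_below[OF countable_below[of d]]]) blast
    then have "\<exists>c. \<Phi> c = avoided d \<sigma> n" for \<sigma> n by (rule \<Phi>_surj)
    then obtain f where f: "\<And>\<sigma> n. \<Phi> (f \<sigma> n) = avoided d \<sigma> n" by metis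
    have "countable {s \<in> S. s < d}" by (rule countable_subset[OF _ countable_below[of d]]) auto
    then obtain c where c: "\<Phi> c = q ` {s \<in> S. s < d}" using \<Phi>_surj countable_image by metis
    have "countable ({c, d} \<union> case_prod f ` ({\<sigma>. spec_pars \<sigma> \<subseteq> {..<d}} \<times> UNIV))"
      using cs by (intro countable_Un countable_image countable_SIGMA) auto
    from countable_bounded[OF this] obtain k where
      k: "\<forall>x \<in> {c, d} \<union> case_prod f ` ({\<sigma>. spec_pars \<sigma> \<subseteq> {..<d}} \<times> UNIV). x < k" by blast
    have "f \<sigma> n < k" if "spec_pars \<sigma> \<subseteq> {..<d}" for \<sigma> n using k that by force
    then have "\<exists>c < k. \<Phi> c = avoided d \<sigma> n" if "spec_pars \<sigma> \<subseteq> {..<d}" for \<sigma> n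
      using that f by blast
    moreover have "c < k" "d \<le> k" using k by auto
    ultimately show ?thesis using c by blast
  qed
  then obtain K where K: "\<And>d. d \<le> K d"
    "\<And>d \<sigma> n. spec_pars \<sigma> \<subseteq> {..<d} \<Longrightarrow> \<exists>c < K d. \<Phi> c = avoided d \<sigma> n"
    "\<And>d. \<exists>c < K d. \<Phi> c = q ` {s \<in> S. s < d}"
    by metis
  define G where "G g = hop (K (cl g))" for g
  have G: "g < cl g" "cl g \<le> K (cl g)" "K (cl g) < G g" for g
    using cl K less_hop by (auto simp: G_def)
  \<comment> \<open>The iteration may start at any index; \<open>undefined\<close> stands for an arbitrary one.\<close>
  obtain D where D: "undefined < D" "\<And>x. x < D \<Longrightarrow> G x < D"
    using closed_index[of undefined G] by blast
  have limit: "\<exists>y < D. x < y" if "x < D" for x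
    using D(2)[OF that] G[of x] by (meson le_less_trans less_trans)
  have "\<exists>s \<in> S. s < D \<and> z y \<in> cyl (q s)" if y: "y \<in> S" for y
  proof -
    let ?A = "spec_pars (shape D (q y)) \<union> (if l y < D then {l y} else {})"
    have "finite ?A" "?A \<subseteq> {..<D}" by (auto simp: spec_pars_shape)
    from bounded_below_limit[OF this D(1) limit] obtain g where
      g: "g < D" "\<And>a. a \<in> ?A \<Longrightarrow> a < g" by blast
    have clD: "cl g < D" and hD: "hop (K (cl g)) \<le> D"
      using G[of g] D(2)[OF g(1)] by (auto simp: G_def)
    have "\<exists>s \<in> S. s < cl g \<and> z y \<in> cyl (q s)"
    proof (cases "l y < D")
      case True
      show ?thesis
        by (rule late_covered_low[OF cl(2) y _ G(1), of D]) (use g(2) True clD in \<open>auto simp: less_imp_le\<close>)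
    next
      case False
      show ?thesis
      proof (rule late_covered_high[OF cl(2) y, of D g "K (cl g)"])
        show "spec_pars (shape D (q y)) \<subseteq> {..<cl g}" using g(2) G(1)[of g] by force
      qed (use False hD G K in auto)
    qed
    then show ?thesis using clD less_trans by blast
  qed
  then show ?thesis by blast
qed

end

section \<open>The topology\<close>

text \<open>
  The topology induced by a map \<open>z\<close> into a power of the two-point space. For injective \<open>z\<close> this is a copy of
  the subspace \<open>range z\<close>.
\<close>

definition cylinder_topology :: "('a \<Rightarrow> 'c \<Rightarrow> bool) \<Rightarrow> 'a topology" where
  "cylinder_topology z = topology (\<lambda>U. \<forall>x \<in> U. \<exists>p. z x \<in> cyl p \<and> z -` cyl p \<subseteq> U)"

lemma openin_cylinder_topology:
  "openin (cylinder_topology z) U \<longleftrightarrow> (\<forall>x \<in> U. \<exists>p. z x \<in> cyl p \<and> z -` cyl p \<subseteq> U)"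
proof -
  have "istopology (\<lambda>U. \<forall>x \<in> U. \<exists>p. z x \<in> cyl p \<and> z -` cyl p \<subseteq> U)"
    unfolding istopology_def
  proof (intro conjI allI impI ballI)
    fix U V x
    assume U: "\<forall>x \<in> U. \<exists>p. z x \<in> cyl p \<and> z -` cyl p \<subseteq> U"
      and V: "\<forall>x \<in> V. \<exists>p. z x \<in> cyl p \<and> z -` cyl p \<subseteq> V" and x: "x \<in> U \<inter> V"
    obtain p q where "z x \<in> cyl p" "z -` cyl p \<subseteq> U" "z x \<in> cyl q" "z -` cyl q \<subseteq> V"
      using U V x by blast
    then show "\<exists>p. z x \<in> cyl p \<and> z -` cyl p \<subseteq> U \<inter> V"
      by (intro exI[of _ "p @ q"]) auto
  next
    fix \<K> x
    assume \<K>: "\<forall>K \<in> \<K>. \<forall>x \<in> K. \<exists>p. z x \<in> cyl p \<and> z -` cyl p \<subseteq> K" and "x \<in> \<Union>\<K>"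
    then obtain K where "K \<in> \<K>" "x \<in> K" by blast
    then obtain p where "z x \<in> cyl p" "z -` cyl p \<subseteq> K" using \<K> by blast
    then show "\<exists>p. z x \<in> cyl p \<and> z -` cyl p \<subseteq> \<Union>\<K>" using \<open>K \<in> \<K>\<close> by blast
  qed
  then show ?thesis by (simp add: cylinder_topology_def topology_inverse')
qed

lemma topspace_cylinder_topology [simp]: "topspace (cylinder_topology z) = UNIV"
proof -
  have "openin (cylinder_topology z) UNIV"
    unfolding openin_cylinder_topology by (intro ballI exI[of _ "[]"]) simp
  then show ?thesis using openin_subset by blast
qed

lemma openin_cylinder: "openin (cylinder_topology z) (z -` cyl p)"
  unfolding openin_cylinder_topology by blast

lemma openin_cylinder_complement: "openin (cylinder_topology z) (- (z -` cyl p))"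
  unfolding openin_cylinder_topology
proof
  fix x assume "x \<in> - (z -` cyl p)"
  then obtain c b where "(c, b) \<in> set p" "z x c \<noteq> b" by (auto simp: cyl_def)
  then show "\<exists>r. z x \<in> cyl r \<and> z -` cyl r \<subseteq> - (z -` cyl p)"
    by (intro exI[of _ "[(c, \<not> b)]"]) (auto dest: cylD)
qed

lemma regular_cylinder_topology: "regular_space (cylinder_topology z)"
  unfolding regular_space_def
proof (intro allI impI)
  fix C a assume a: "closedin (cylinder_topology z) C \<and> a \<in> topspace (cylinder_topology z) - C"
  then have "openin (cylinder_topology z) (- C)"
    by (simp add: closedin_def Compl_eq_Diff_UNIV)
  then obtain p where p: "z a \<in> cyl p" "z -` cyl p \<subseteq> - C"
    using a unfolding openin_cylinder_topology by blast
  have "disjnt (z -` cyl p) (- (z -` cyl p))" by (simp add: disjnt_def)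
  then show "\<exists>U V. openin (cylinder_topology z) U \<and> openin (cylinder_topology z) V \<and>
      a \<in> U \<and> C \<subseteq> V \<and> disjnt U V"
    using p openin_cylinder[of z p] openin_cylinder_complement[of z p] by blast
qed

lemma Hausdorff_cylinder_topology:
  assumes "inj z"
  shows "Hausdorff_space (cylinder_topology z)"
  unfolding Hausdorff_space_def
proof (intro allI impI)
  fix x y assume "x \<in> topspace (cylinder_topology z) \<and> y \<in> topspace (cylinder_topology z) \<and> x \<noteq> y"
  then have "z x \<noteq> z y" using assms by (auto dest: injD)
  then obtain c where "z x c \<noteq> z y c" by blast
  then have "x \<in> z -` cyl [(c, z x c)]" "y \<in> - (z -` cyl [(c, z x c)])" by auto
  moreover have "disjnt (z -` cyl [(c, z x c)]) (- (z -` cyl [(c, z x c)]))" by (simp add: disjnt_def)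
  ultimately show "\<exists>U V. openin (cylinder_topology z) U \<and> openin (cylinder_topology z) V \<and>
      x \<in> U \<and> y \<in> V \<and> disjnt U V"
    using openin_cylinder[of z "[(c, z x c)]"] openin_cylinder_complement[of z "[(c, z x c)]"]
    by (intro exI conjI)
qed

lemma Lindelof_discrete_countable:
  assumes "Lindelof_space (discrete_topology D)"
  shows "countable D"
proof -
  have "\<exists>\<V>. countable \<V> \<and> \<V> \<subseteq> (\<lambda>x. {x}) ` D \<and> \<Union>\<V> = topspace (discrete_topology D)"
    by (rule Lindelof_spaceD[OF assms]) auto
  then obtain \<V> where \<V>: "countable \<V>" "\<V> \<subseteq> (\<lambda>x. {x}) ` D" "\<Union>\<V> = D" by auto
  have "countable (\<Union>V \<in> \<V>. V)"
    using \<V>(1,2) by (intro countable_UN) auto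
  then show ?thesis using \<V>(3) by simp
qed

context tower
begin

text \<open>
  The map \<open>f\<close> serves to carry the space to another underlying set.
\<close>

lemma hereditarily_Lindelof:
  "hereditarily Lindelof_space (cylinder_topology (\<lambda>x. z (f x)))"
  unfolding hereditarily_def
proof (intro allI impI)
  let ?X = "cylinder_topology (\<lambda>x. z (f x))"
  fix S assume "S \<subseteq> topspace ?X"
  show "Lindelof_space (subtopology ?X S)"
    unfolding Lindelof_space_subtopology_subset[OF \<open>S \<subseteq> _\<close>]
  proof (intro allI impI)
    fix \<U> assume \<U>: "(\<forall>U \<in> \<U>. openin ?X U) \<and> S \<subseteq> \<Union>\<U>"
    have "\<exists>p U. U \<in> \<U> \<and> z a \<in> cyl p \<and> (\<lambda>x. z (f x)) -` cyl p \<subseteq> U" if a: "a \<in> f ` S" for a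
    proof -
      obtain s where "s \<in> S" "a = f s" using a by blast
      then obtain U where "U \<in> \<U>" "s \<in> U" using \<U> by blast
      then show ?thesis using \<U> \<open>a = f s\<close> unfolding openin_cylinder_topology by blast
    qed
    then obtain q U where qU: "\<And>a. a \<in> f ` S \<Longrightarrow> U a \<in> \<U>" "\<And>a. a \<in> f ` S \<Longrightarrow> z a \<in> cyl (q a)"
      "\<And>a. a \<in> f ` S \<Longrightarrow> (\<lambda>x. z (f x)) -` cyl (q a) \<subseteq> U a"
      by metis
    interpret tower_cover seq E \<Phi> z B l "f ` S" q by unfold_locales (rule qU(2))
    obtain d where d: "\<And>y. y \<in> f ` S \<Longrightarrow> \<exists>a \<in> f ` S. a < d \<and> z y \<in> cyl (q a)"
      using cover_bounded by blast
    let ?V = "U ` {a \<in> f ` S. a < d}"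
    have "countable {a \<in> f ` S. a < d}" by (rule countable_subset[OF _ countable_below[of d]]) auto
    then have "countable ?V" by simp
    moreover have "?V \<subseteq> \<U>" using qU(1) by blast
    moreover have "S \<subseteq> \<Union>?V"
    proof
      fix x assume "x \<in> S"
      then obtain a where a: "a \<in> f ` S" "a < d" "z (f x) \<in> cyl (q a)" using d by blast
      then have "x \<in> U a" using qU(3) by blast
      then show "x \<in> \<Union>?V" using a by blast
    qed
    ultimately show "\<exists>V. countable V \<and> V \<subseteq> \<U> \<and> S \<subseteq> \<Union>V" by blast
  qed
qed

text \<open>
  Consider the stage \<open>b\<close> that deals with \<open>D\<close>. In the second alternative \<open>b \<notin> D\<close> would be a limit point
  of \<open>D\<close>, so the first one applies.
\<close>

lemma countable_closed_misses:
  assumes "surj f" and D: "closedin (cylinder_topology (\<lambda>x. z (f x))) D" "countable D"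
  shows "\<exists>y. \<forall>a \<in> D. z (f y) (Inr (f a))"
proof (cases "D = {}")
  case False
  then obtain b where b: "E b = f ` D" using E_surj[of "f ` D"] D(2) by auto
  obtain y where y: "f y = b" using \<open>surj f\<close> by (metis surjD)
  from stage[of b] show ?thesis
  proof (elim disjE exE conjE)
    assume "B b = E b"
    then have "\<forall>a \<in> D. z (f y) (Inr (f a))" using z_slab[of b] b y by (simp add: slab_def)
    then show ?thesis by blast
  next
    fix g m p
    assume r: "reaches z (E b) (B g) (l g) m p" and B: "B b = B g \<inter> {..<m}" "l b = m"
      and p: "z b \<in> cyl p"
    have "y \<notin> D" using E_below[of b] b y by blast
    moreover have "openin (cylinder_topology (\<lambda>x. z (f x))) (- D)"
      using D(1) by (simp add: closedin_def Compl_eq_Diff_UNIV)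
    ultimately obtain r where r': "z b \<in> cyl r" "(\<lambda>x. z (f x)) -` cyl r \<subseteq> - D"
      using y unfolding openin_cylinder_topology by blast
    have "slab (B g \<inter> {..<m}) m \<inter> cyl p \<inter> cyl r \<noteq> {}"
      using z_slab[of b] B p r'(1) by auto
    then have "z ` E b \<inter> cyl p \<inter> cyl r \<noteq> {}"
      using r unfolding reaches_def dense_on_def by blast
    then obtain a where "a \<in> E b" "z a \<in> cyl r" by auto
    then obtain x where "x \<in> D" "z (f x) \<in> cyl r" using b by auto
    then show ?thesis using r'(2) by auto
  qed
qed simp

lemma not_D_space:
  assumes "surj f"
  shows "\<not> D_space (cylinder_topology (\<lambda>x. z (f x)))"
proof
  let ?X = "cylinder_topology (\<lambda>x. z (f x))"
  assume D: "D_space ?X"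
  define N where "N a = (\<lambda>x. z (f x)) -` cyl [(Inr (f a), False)]" for a
  have "neighbourhood_assignment ?X N"
    unfolding neighbourhood_assignment_def
  proof (intro ballI conjI)
    fix a
    show "openin ?X (N a)" unfolding N_def by (rule openin_cylinder)
    show "a \<in> N a" using z_slab[of "f a"] l_le[of "f a"] by (simp add: N_def slab_def)
  qed
  then obtain C where C: "closed_discrete_in ?X C" "UNIV = (\<Union>x \<in> C. N x)"
    using D unfolding D_space_def by auto
  have "Lindelof_space (subtopology ?X C)"
    using hereditarily_Lindelof[of f] unfolding hereditarily_def by simp
  then have "countable C"
    using C(1) Lindelof_discrete_countable by (simp add: closed_discrete_in_def)
  moreover have "closedin ?X C"
    using C(1) by (simp add: closed_discrete_in_def)
  ultimately obtain y where "\<forall>a \<in> C. z (f y) (Inr (f a))"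
    using countable_closed_misses[OF assms] by blast
  then have "y \<notin> (\<Union>x \<in> C. N x)" by (auto simp: N_def)
  then show False using C(2) by blast
qed

end

section \<open>The index set and the theorem\<close>

text \<open>
  A copy of the real numbers that carries a well-order of minimal order type.
\<close>

typedef idx = "UNIV :: real set" ..

instantiation idx :: wellorder
begin

definition less_eq_idx :: "idx \<Rightarrow> idx \<Rightarrow> bool" where
  "less_eq_idx a b \<longleftrightarrow> (Rep_idx a, Rep_idx b) \<in> |UNIV :: real set|"

definition less_idx :: "idx \<Rightarrow> idx \<Rightarrow> bool" where
  "less_idx a b \<longleftrightarrow> a \<le> b \<and> a \<noteq> b"

instance
proof -
  let ?r = "|UNIV :: real set|"
  have wo: "Well_order ?r" and field: "Field ?r = UNIV"
    by (rule card_of_Well_order) (rule Field_card_of)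
  then have "refl ?r" "trans ?r" "antisym ?r" "total ?r" "wf (?r - Id)"
    by (auto simp: order_on_defs)
  note order = refl_onD[OF this(1)] transD[OF this(2)] antisymD[OF this(3)]
  show "OFCLASS(idx, wellorder_class)"
  proof
    fix a b c :: idx
    show "a < b \<longleftrightarrow> a \<le> b \<and> \<not> b \<le> a"
      using order(3) unfolding less_idx_def less_eq_idx_def by (metis Rep_idx_inject)
    show "a \<le> a" using order(1) by (simp add: less_eq_idx_def)
    show "a \<le> b \<Longrightarrow> b \<le> c \<Longrightarrow> a \<le> c" using order(2) unfolding less_eq_idx_def by blast
    show "a \<le> b \<Longrightarrow> b \<le> a \<Longrightarrow> a = b"
      using order(3) unfolding less_eq_idx_def by (metis Rep_idx_inject)
    show "a \<le> b \<or> b \<le> a"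
      using \<open>total ?r\<close> order(1) unfolding less_eq_idx_def total_on_def by (metis UNIV_I)
  next
    fix P :: "idx \<Rightarrow> bool" and a :: idx
    assume step: "\<And>x. (\<And>y. y < x \<Longrightarrow> P y) \<Longrightarrow> P x"
    have "wf (inv_image (?r - Id) Rep_idx)"
      using \<open>wf (?r - Id)\<close> by (rule wf_inv_image)
    moreover have "inv_image (?r - Id) Rep_idx = {(a, b). a < b}"
      by (auto simp: inv_image_def less_idx_def less_eq_idx_def Rep_idx_inject)
    ultimately have "wf {(a :: idx, b). a < b}" by simp
    then show "P a"
      by (induction a rule: wf_induct_rule) (use step in blast)
  qed
qed

end

lemma real_aleph1:
  assumes continuum_hypothesis
  shows "|UNIV :: real set| =o aleph1"
proof -
  have "|UNIV :: real set| =o |UNIV :: nat set set|"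
    using nat_sets_eqpoll_reals unfolding eqpoll_def
    by (meson card_of_ordIso ordIso_symmetric)
  also have "|UNIV :: nat set set| =o ctwo ^c natLeq"
    using card_of_Pow_Func[of "UNIV :: nat set"]
    by (simp add: cexp_def ctwo_def Field_card_of Field_natLeq)
  also have "ctwo ^c natLeq =o aleph1"
    using assms by (simp add: continuum_hypothesis_def)
  finally show ?thesis .
qed

lemma countable_below_idx:
  assumes continuum_hypothesis
  shows "countable {..<a :: idx}"
proof -
  let ?r = "|UNIV :: real set|"
  have "|underS ?r (Rep_idx a)| <o ?r"
    by (rule card_of_underS[OF card_of_Card_order]) (simp add: Field_card_of)
  also have "?r =o aleph1" using real_aleph1[OF assms] .
  finally have "|underS ?r (Rep_idx a)| \<le>o natLeq"
    using cardSuc_ordLeq_ordLess[OF natLeq_Card_order card_of_Card_order] by blast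
  then have "countable (underS ?r (Rep_idx a))"
    by (simp add: countable_card_le_natLeq)
  moreover have "Rep_idx ` {..<a} \<subseteq> underS ?r (Rep_idx a)"
    by (auto simp: underS_def less_idx_def less_eq_idx_def Rep_idx_inject)
  ultimately have "countable (Rep_idx ` {..<a})"
    using countable_subset by blast
  then show ?thesis
    by (rule countable_image_inj_on) (simp add: inj_on_def Rep_idx_inject)
qed

lemma surj_sequences: "\<exists>seq :: idx \<Rightarrow> nat \<Rightarrow> idx. surj seq"
proof -
  obtain g :: "nat set \<Rightarrow> real" where g: "bij g"
    using nat_sets_eqpoll_reals unfolding eqpoll_def by blast
  define seq where "seq a n = Abs_idx (g {k. prod_encode (n, k) \<in> inv g (Rep_idx a)})" for a n
  have "\<exists>a. seq a = u" for u
  proof -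
    define M where "M = {m. case prod_decode m of (n, k) \<Rightarrow> k \<in> inv g (Rep_idx (u n))}"
    have "seq (Abs_idx (g M)) = u"
      using g by (simp add: seq_def M_def Abs_idx_inverse Rep_idx_inverse bij_is_inj
          bij_is_surj surj_f_inv_f fun_eq_iff)
    then show ?thesis by blast
  qed
  then have "surj seq" unfolding surj_def by metis
  then show ?thesis by blast
qed

theorem theorem1p1:
  assumes "continuum_hypothesis"
  shows "\<exists>X :: real topology.
           Hausdorff_space X \<and> regular_space X \<and> hereditarily Lindelof_space X \<and>
           |topspace X| =o aleph1 \<and> \<not> D_space X"
proof -
  obtain seq :: "idx \<Rightarrow> nat \<Rightarrow> idx" where "surj seq" using surj_sequences by blast
  moreover have bij: "bij Abs_idx"
    by (metis (mono_tags) UNIV_I bij_def inj_on_def Abs_idx_inverse Rep_idx_inverse surj_def)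
  then have "uncountable (UNIV :: idx set)"
    by (metis bij_betw_def countable_image_inj_on uncountable_UNIV_real)
  ultimately interpret omega_one seq
    using countable_below_idx[OF assms] by unfold_locales
  obtain E \<Phi> z B l where "tower seq E \<Phi> z B l" using tower_exists by blast
  then interpret tower seq E \<Phi> z B l .
  let ?X = "cylinder_topology (\<lambda>x. z (Abs_idx x))"
  have "inj (\<lambda>x. z (Abs_idx x))"
    using inj_z bij by (simp add: inj_def bij_def)
  then have "Hausdorff_space ?X" by (rule Hausdorff_cylinder_topology)
  moreover have "|topspace ?X| =o aleph1" using real_aleph1[OF assms] by simp
  ultimately show ?thesis
    using regular_cylinder_topology hereditarily_Lindelof not_D_space[OF bij_is_surj[OF bij]] by blast
qed

end
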